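(* Let $\mathcal X,\mathcal Y$ be complex Banach spaces, let $A\in\mathcal B(\mathcal X)$, $B\in\mathcal B(\mathcal Y)$ and $C\in\mathcal B(\mathcal Y,\mathcal X)$, and let $p$ be a polynomial with complex coefficients such that $\sigma(p(A))\cap\sigma(p(B))=\emptyset$. Let $q(\lambda,\mu)=\dfrac{p(\lambda)-p(\mu)}{\lambda-\mu}$ be the divided difference of $p$. Then the equation $$p(A)X-Xp(B)=q(A,B)(C)$$ has a unique solution $X\in\mathcal B(\mathcal Y,\mathcal X)$, and this $X$ also satisfies $AX-XB=C$.
   Context: $\mathcal B(\mathcal Y,\mathcal X)$ denotes the bounded linear operators from $\mathcal Y$ to $\mathcal X$, and $\mathcal B(\mathcal X)=\mathcal B(\mathcal X,\mathcal X)$; $\sigma(T)$ is the spectrum of $T$. For a bivariate polynomial $f(\lambda,\mu)=\sum_{i,j}\alpha_{ij}\lambda^i\mu^j$, $f(A,B)$ denotes the linear map on $\mathcal B(\mathcal Y,\mathcal X)$ given by $f(A,B)(Z)=\sum_{i,j}\alpha_{ij}A^iZB^j$. The divided difference $q$ is a bivariate polynomial: if $p(\lambda)=\sum_{k=0}^d\alpha_k\lambda^k$ then $q(\lambda,\mu)=\sum_{k=1}^d\alpha_k(\lambda^{k-1}+\lambda^{k-2}\mu+\cdots+\mu^{k-1})$. *)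

theory Defs
  imports "HOL-Analysis.Analysis" "HOL-Computational_Algebra.Polynomial"
begin

text \<open>
  \<open>HOL-Analysis\<close> only provides real normed spaces. A complex one is a real one with a complex
  scalar multiplication that extends \<open>scaleR\<close> and for which the norm is homogeneous.
\<close>

class complex_normed_vector = real_normed_vector +
  fixes scaleC :: "complex \<Rightarrow> 'a \<Rightarrow> 'a" (infixr \<open>*\<^sub>C\<close> 75)
  assumes scaleC_add_right: "a *\<^sub>C (x + y) = a *\<^sub>C x + a *\<^sub>C y"
    and scaleC_add_left: "(a + b) *\<^sub>C x = a *\<^sub>C x + b *\<^sub>C x"
    and scaleC_scaleC: "a *\<^sub>C b *\<^sub>C x = (a * b) *\<^sub>C x"
    and scaleC_one: "1 *\<^sub>C x = x"
    and scaleC_of_real: "complex_of_real r *\<^sub>C x = r *\<^sub>R x"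
    and norm_scaleC: "norm (a *\<^sub>C x) = cmod a * norm x"

class complex_banach = complex_normed_vector + banach

instantiation complex :: complex_banach
begin

definition scaleC_complex :: "complex \<Rightarrow> complex \<Rightarrow> complex" where
  "scaleC_complex a x = a * x"

instance
  by standard (simp_all add: scaleC_complex_def algebra_simps norm_mult scaleR_conv_of_real)

end

definition bounded_clinear ::
  "('a::complex_normed_vector \<Rightarrow> 'b::complex_normed_vector) \<Rightarrow> bool" where
  "bounded_clinear T \<longleftrightarrow> bounded_linear T \<and> (\<forall>c x. T (c *\<^sub>C x) = c *\<^sub>C T x)"

definition spectrum :: "('a::complex_banach \<Rightarrow> 'a) \<Rightarrow> complex set" where
  "spectrum T = {c. \<not> (\<exists>S. bounded_clinear S \<and>
     S \<circ> (\<lambda>x. T x - c *\<^sub>C x) = id \<and> (\<lambda>x. T x - c *\<^sub>C x) \<circ> S = id)}"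

definition poly_op :: "complex poly \<Rightarrow> ('a::complex_banach \<Rightarrow> 'a) \<Rightarrow> 'a \<Rightarrow> 'a" where
  "poly_op p T = (\<lambda>x. \<Sum>k\<le>degree p. coeff p k *\<^sub>C (T ^^ k) x)"

text \<open>
  A bivariate polynomial \<open>f(\<lambda>,\<mu>)\<close> is encoded as \<open>f :: complex poly poly\<close>, the outer variable
  being \<open>\<lambda>\<close>: the coefficient of \<open>\<lambda>\<^sup>i\<mu>\<^sup>j\<close> is \<open>coeff (coeff f i) j\<close>, and the value at \<open>(a, b)\<close> is
  \<open>poly (poly f [:a:]) b\<close>.
\<close>

definition bipoly_op :: "complex poly poly \<Rightarrow> ('a::complex_banach \<Rightarrow> 'a) \<Rightarrow>
    ('b::complex_banach \<Rightarrow> 'b) \<Rightarrow> ('b \<Rightarrow> 'a) \<Rightarrow> 'b \<Rightarrow> 'a" where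
  "bipoly_op f A B Z = (\<lambda>y. \<Sum>i\<le>degree f. \<Sum>j\<le>degree (coeff f i).
     coeff (coeff f i) j *\<^sub>C (A ^^ i) (Z ((B ^^ j) y)))"

definition divided_difference :: "complex poly \<Rightarrow> complex poly poly" where
  "divided_difference p =
     (\<Sum>k=1..degree p. \<Sum>i<k. monom (monom (coeff p k) (k - 1 - i)) i)"

lemma divided_difference_eq:
  "(a - b) * poly (poly (divided_difference p) [:a:]) b = poly p a - poly p b"
proof -
  have "(a - b) * poly (poly (divided_difference p) [:a:]) b =
      (\<Sum>k=1..degree p. coeff p k * ((a - b) * (\<Sum>i<k. b ^ (k - Suc i) * a ^ i)))"
    by (simp add: divided_difference_def poly_sum poly_monom sum_distrib_left mult_ac)
  also have "\<dots> = (\<Sum>k=1..degree p. coeff p k * (a ^ k - b ^ k))"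
    by (simp add: power_diff_sumr2)
  also have "\<dots> = (\<Sum>k\<le>degree p. coeff p k * (a ^ k - b ^ k))"
    by (rule sum.mono_neutral_left) (auto simp: not_less_eq_eq)
  also have "\<dots> = poly p a - poly p b"
    by (simp add: poly_altdef right_diff_distrib sum_subtractf)
  finally show ?thesis .
qed

end

theory Submission
  imports Defs
begin

text \<open>
  Write \<open>T X = A X - X B\<close> and \<open>S X = p(A) X - X p(B)\<close>. Telescoping gives \<open>S = q(A,B) T = T q(A,B)\<close>.
  If \<open>S\<close> is bijective and \<open>S X = q(A,B)(C)\<close>, then \<open>S (T X) = T (S X) = T (q(A,B)(C)) = S C\<close>, hence \<open>T X = C\<close>.

  Bijectivity of \<open>X \<mapsto> P X - X Q\<close> for operators \<open>P\<close> and \<open>Q\<close> with disjoint spectra is Rosenblum's theorem.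
  Instead of a contour separating the spectra, a differentiable cutoff \<open>u\<close> is used: off the spectra,
  \<open>R\<^sub>P(z) Z - Z R\<^sub>Q(z) = - (P K - K Q)\<close> with \<open>K = R\<^sub>P(z) Z R\<^sub>Q(z)\<close>, so the Cauchy--Pompeiu formula for
  \<open>u R\<^sub>P(z) Z + (1 - u) Z R\<^sub>Q(z)\<close> expresses \<open>Z\<close> through an area integral of \<open>(u\<^sub>x + \<i> u\<^sub>y) (P K - K Q)\<close>,
  and the same integral of \<open>K\<close> is a solution. If \<open>P Z = Z Q\<close> the integrand vanishes, and so does \<open>Z\<close>.
\<close>

section \<open>Complex scalar multiplication on spaces of bounded operators\<close>

text \<open>Real bilinearity makes the limit, derivative and integral rules for bounded bilinear
  maps available for \<open>*\<^sub>C\<close>.\<close>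

lemma bounded_bilinear_scaleC: "bounded_bilinear ((*\<^sub>C) :: complex \<Rightarrow> 'a::complex_normed_vector \<Rightarrow> 'a)"
proof
  fix r :: real and c :: complex and x :: 'a
  have "(r *\<^sub>R c) *\<^sub>C x = (complex_of_real r * c) *\<^sub>C x"
    by (simp add: scaleR_conv_of_real)
  also have "\<dots> = r *\<^sub>R (c *\<^sub>C x)"
    by (metis scaleC_scaleC scaleC_of_real)
  finally show "(r *\<^sub>R c) *\<^sub>C x = r *\<^sub>R (c *\<^sub>C x)" .
  have "c *\<^sub>C (r *\<^sub>R x) = (c * complex_of_real r) *\<^sub>C x"
    by (metis scaleC_scaleC scaleC_of_real)
  also have "\<dots> = r *\<^sub>R (c *\<^sub>C x)"
    by (metis mult.commute scaleC_scaleC scaleC_of_real)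
  finally show "c *\<^sub>C (r *\<^sub>R x) = r *\<^sub>R (c *\<^sub>C x)" .
  show "\<exists>K. \<forall>a b. norm (a *\<^sub>C b :: 'a) \<le> norm a * norm b * K"
    by (rule exI[of _ 1]) (simp add: norm_scaleC)
qed (rule scaleC_add_right scaleC_add_left)+

interpretation scaleC: bounded_bilinear "(*\<^sub>C) :: complex \<Rightarrow> 'a::complex_normed_vector \<Rightarrow> 'a"
  by (rule bounded_bilinear_scaleC)

lemmas scaleC_simps =
  scaleC.zero_left scaleC.zero_right scaleC_one scaleC_scaleC scaleC.minus_left scaleC.minus_right

text \<open>Scalars act on the values, so the type contains all bounded real-linear maps; complex
  linearity is carried separately as \<open>clinear_blinfun\<close>. The resulting complex Banach
  space is where the operator-valued integrals live.\<close>

instantiation blinfun :: (real_normed_vector, complex_normed_vector) complex_normed_vector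
begin

definition scaleC_blinfun :: "complex \<Rightarrow> ('a \<Rightarrow>\<^sub>L 'b) \<Rightarrow> 'a \<Rightarrow>\<^sub>L 'b" where
  "scaleC_blinfun c f = Blinfun (\<lambda>x. c *\<^sub>C blinfun_apply f x)"

lemma blinfun_apply_scaleC: "blinfun_apply (c *\<^sub>C f) x = c *\<^sub>C blinfun_apply f x"
  for f :: "'a \<Rightarrow>\<^sub>L 'b"
proof -
  have "bounded_linear (\<lambda>x. c *\<^sub>C blinfun_apply f x)"
    by (rule bounded_linear_compose[OF scaleC.bounded_linear_right blinfun.bounded_linear_right])
  then show ?thesis
    by (simp add: scaleC_blinfun_def bounded_linear_Blinfun_apply)
qed

instance
proof
  fix a b :: complex and r :: real and f g :: "'a \<Rightarrow>\<^sub>L 'b"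
  have le: "norm (c *\<^sub>C h) \<le> cmod c * norm h" for c :: complex and h :: "'a \<Rightarrow>\<^sub>L 'b"
    by (rule norm_blinfun_bound)
      (auto simp: blinfun_apply_scaleC norm_scaleC mult.assoc intro!: mult_left_mono norm_blinfun)
  show "a *\<^sub>C (f + g) = a *\<^sub>C f + a *\<^sub>C g"
    by (rule blinfun_eqI) (simp add: blinfun_apply_scaleC blinfun.add_left scaleC_add_right)
  show "(a + b) *\<^sub>C f = a *\<^sub>C f + b *\<^sub>C f"
    by (rule blinfun_eqI) (simp add: blinfun_apply_scaleC blinfun.add_left scaleC_add_left)
  show assoc: "c *\<^sub>C d *\<^sub>C h = (c * d) *\<^sub>C h" for c d and h :: "'a \<Rightarrow>\<^sub>L 'b"
    by (rule blinfun_eqI) (simp add: blinfun_apply_scaleC scaleC_scaleC)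
  show one: "1 *\<^sub>C h = h" for h :: "'a \<Rightarrow>\<^sub>L 'b"
    by (rule blinfun_eqI) (simp add: blinfun_apply_scaleC scaleC_one)
  show "complex_of_real r *\<^sub>C f = r *\<^sub>R f"
    by (rule blinfun_eqI) (simp add: blinfun_apply_scaleC blinfun.scaleR_left scaleC_of_real)
  show "norm (a *\<^sub>C f) = cmod a * norm f"
  proof (cases "a = 0")
    case True
    then show ?thesis
      using le[of 0 f] by simp
  next
    case False
    \<comment> \<open>The reverse inequality is \<open>le\<close> for the inverse scalar, applied to
      \<open>a *\<^sub>C f\<close>.\<close>
    have "norm f \<le> cmod (inverse a) * norm (a *\<^sub>C f)"
      using le[of "inverse a" "a *\<^sub>C f"] False by (simp add: assoc one)
    then have "cmod a * norm f \<le> norm (a *\<^sub>C f)"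
      using False by (metis (no_types, lifting) norm_inverse inverse_eq_divide divide_inverse_commute
          mult.commute pos_le_divide_eq zero_less_norm_iff)
    with le[of a f] show ?thesis
      by simp
  qed
qed

end

instance blinfun :: (real_normed_vector, complex_banach) complex_banach ..

lemma scaleC_blinfun_compose: "(c *\<^sub>C f) o\<^sub>L g = c *\<^sub>C (f o\<^sub>L g)"
  by (rule blinfun_eqI) (simp add: blinfun_apply_scaleC)

section \<open>Continuously differentiable cutoff functions in the plane\<close>

text \<open>C1 maps on the plane in the real sense. The partials are carried explicitly because the
  d-bar derivative, \<open>fx\<close> plus \<open>\<i>\<close> times \<open>fy\<close>, is formed
  from them.\<close>

definition has_partials ::
    "(complex \<Rightarrow> 'e::real_normed_vector) \<Rightarrow> (complex \<Rightarrow> 'e) \<Rightarrow> (complex \<Rightarrow> 'e) \<Rightarrow> bool" where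
  "has_partials f fx fy \<longleftrightarrow> continuous_on UNIV fx \<and> continuous_on UNIV fy \<and>
     (\<forall>z. (f has_derivative (\<lambda>h. Re h *\<^sub>R fx z + Im h *\<^sub>R fy z)) (at z))"

lemma has_partials_derivative:
  "has_partials f fx fy \<Longrightarrow> (f has_derivative (\<lambda>h. Re h *\<^sub>R fx z + Im h *\<^sub>R fy z)) (at z)"
  by (simp add: has_partials_def)

lemma has_partials_continuous_on:
  assumes "has_partials f fx fy"
  shows "continuous_on S f"
  using has_derivative_continuous[OF has_partials_derivative[OF assms]]
  by (simp add: continuous_at_imp_continuous_on)

lemma has_partials_add:
  assumes "has_partials f fx fy" "has_partials g gx gy"
  shows "has_partials (\<lambda>z. f z + g z) (\<lambda>z. fx z + gx z) (\<lambda>z. fy z + gy z)"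
  using assms unfolding has_partials_def
  by (auto intro!: continuous_intros derivative_eq_intros simp: algebra_simps)

lemma has_partials_mult:
  fixes f g :: "complex \<Rightarrow> real"
  assumes f: "has_partials f fx fy" and g: "has_partials g gx gy"
  shows "has_partials (\<lambda>z. f z * g z) (\<lambda>z. f z * gx z + fx z * g z) (\<lambda>z. f z * gy z + fy z * g z)"
  using assms has_partials_continuous_on[OF f] has_partials_continuous_on[OF g]
  unfolding has_partials_def
  by (auto intro!: continuous_intros derivative_eq_intros simp: algebra_simps)

lemma has_partials_const: "has_partials (\<lambda>z. c) (\<lambda>z. 0) (\<lambda>z. 0)"
  unfolding has_partials_def by (auto intro!: continuous_intros derivative_eq_intros)

lemma has_partials_one_minus:
  fixes f :: "complex \<Rightarrow> real"
  assumes "has_partials f fx fy"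
  shows "has_partials (\<lambda>z. 1 - f z) (\<lambda>z. - fx z) (\<lambda>z. - fy z)"
  using assms unfolding has_partials_def
  by (auto intro!: continuous_intros derivative_eq_intros simp: algebra_simps)

text \<open>For a cutoff, this makes the d-bar derivative vanish near both spectra, where one of the
  resolvents is undefined.\<close>

lemma has_partials_const_on_open:
  fixes f :: "complex \<Rightarrow> 'e::real_normed_vector"
  assumes f: "has_partials f fx fy" and S: "open S" "z \<in> S" and c: "\<And>x. x \<in> S \<Longrightarrow> f x = c"
  shows "fx z = 0" "fy z = 0"
proof -
  have "(f has_derivative (\<lambda>h. 0)) (at z)"
    by (rule has_derivative_transform_within_open[OF has_derivative_const[of c] S]) (simp add: c)
  then have "(\<lambda>h. Re h *\<^sub>R fx z + Im h *\<^sub>R fy z) = (\<lambda>h. 0)"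
    by (rule has_derivative_unique[OF has_partials_derivative[OF f]])
  from fun_cong[OF this, of 1] fun_cong[OF this, of \<i>] show "fx z = 0" "fy z = 0"
    by simp_all
qed

text \<open>The squared positive part: flat on a half-line, yet with the continuous derivative
  \<open>2 * max 0 t\<close>. It is the building block of a C1 step function.\<close>

definition possq :: "real \<Rightarrow> real" where
  "possq t = (max 0 t)\<^sup>2"

lemma has_real_derivative_possq [derivative_intros]:
  "(possq has_real_derivative 2 * max 0 t) (at t)"
proof (cases "t = 0")
  case True
  \<comment> \<open>At the junction the difference quotient is \<open>h\<close> or 0.\<close>
  have "((\<lambda>h. possq h / h) \<longlongrightarrow> 0) (at 0)"
  proof (rule Lim_null_comparison)
    show "((\<lambda>h. norm h) \<longlongrightarrow> 0) (at (0::real))"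
      by (rule tendsto_eq_intros refl | simp)+
    show "\<forall>\<^sub>F h in at 0. norm (possq h / h) \<le> norm h"
      by (auto simp: possq_def max_def power2_eq_square)
  qed
  then show ?thesis
    using True by (simp add: has_field_derivative_iff possq_def)
next
  case False
  consider "t > 0" | "t < 0" using False by linarith
  then show ?thesis
  proof cases
    case 1
    have "((\<lambda>t. t\<^sup>2) has_real_derivative 2 * max 0 t) (at t)"
      using 1 by (auto intro!: derivative_eq_intros)
    then show ?thesis
      by (rule has_field_derivative_transform_within_open[where S="{0<..}"])
        (use 1 in \<open>auto simp: possq_def\<close>)
  next
    case 2
    have "((\<lambda>t. 0) has_real_derivative 2 * max 0 t) (at t)"
      using 2 by (auto intro!: derivative_eq_intros)
    then show ?thesis
      by (rule has_field_derivative_transform_within_open[where S="{..<0}"])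
        (use 2 in \<open>auto simp: possq_def\<close>)
  qed
qed

lemma has_partials_compose_real:
  fixes f :: "complex \<Rightarrow> real"
  assumes f: "has_partials f fx fy" and g: "\<And>t. (g has_real_derivative g' t) (at t)"
    and g': "continuous_on UNIV g'"
  shows "has_partials (\<lambda>z. g (f z)) (\<lambda>z. g' (f z) * fx z) (\<lambda>z. g' (f z) * fy z)"
proof -
  have "((\<lambda>z. g (f z)) has_derivative (\<lambda>h. (Re h *\<^sub>R fx z + Im h *\<^sub>R fy z) * g' (f z))) (at z)" for z
    by (rule has_derivative_compose[OF has_partials_derivative[OF f]
        g[unfolded has_field_derivative_def, of "f z", THEN has_derivative_eq_rhs], of "\<lambda>x. x * g' (f z)"])
      (simp add: fun_eq_iff mult.commute)
  moreover have "continuous_on UNIV (\<lambda>z. g' (f z))"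
    by (rule continuous_on_compose2[OF g' has_partials_continuous_on[OF f]]) simp
  ultimately show ?thesis
    using f unfolding has_partials_def by (auto intro!: continuous_intros simp: algebra_simps)
qed

lemma ex_bump_ball:
  assumes "d > 0"
  shows "\<exists>u ux uy. has_partials u ux uy \<and> (\<forall>z\<in>ball c d. u z = 0) \<and> (\<forall>z. z \<notin> ball c (2*d) \<longrightarrow> u z = (1::real))"
proof -
  \<comment> \<open>\<open>n\<close> is at most 0 on the inner ball and at least 3 off the outer
    one; the squared distance keeps it differentiable at \<open>c\<close>. \<open>g\<close> is a C1
    step: 0 for \<open>t \<le> 0\<close> and 1 for \<open>t \<ge> 1\<close>.\<close>
  define n where "n z = ((Re (z - c))\<^sup>2 + (Im (z - c))\<^sup>2) / d\<^sup>2 - 1" for z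
  define g where "g t = 1 - possq (1 - possq t)" for t
  have nn: "n z = (cmod (z - c) / d)\<^sup>2 - 1" for z
    by (simp add: n_def cmod_power2 power_divide)
  have "has_partials n (\<lambda>z. 2 * Re (z - c) / d\<^sup>2) (\<lambda>z. 2 * Im (z - c) / d\<^sup>2)"
    unfolding has_partials_def n_def
    by (auto intro!: continuous_intros derivative_eq_intros simp: algebra_simps add_divide_distrib)
       (use assms in \<open>auto simp: fun_eq_iff field_simps power4_eq_xxxx power2_eq_square\<close>)
  moreover have "(g has_real_derivative 2 * max 0 (1 - possq t) * (2 * max 0 t)) (at t)" for t
    unfolding g_def
    by (auto intro!: derivative_eq_intros DERIV_chain2[OF has_real_derivative_possq])
  moreover have "continuous_on UNIV (\<lambda>t. 2 * max 0 (1 - possq t) * (2 * max 0 t))"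
    unfolding possq_def by (intro continuous_intros)
  ultimately have 1: "has_partials (\<lambda>z. g (n z))
      (\<lambda>z. 2 * max 0 (1 - possq (n z)) * (2 * max 0 (n z)) * (2 * Re (z - c) / d\<^sup>2))
      (\<lambda>z. 2 * max 0 (1 - possq (n z)) * (2 * max 0 (n z)) * (2 * Im (z - c) / d\<^sup>2))"
    by (rule has_partials_compose_real)
  have 2: "g (n z) = 0" if "z \<in> ball c d" for z
  proof -
    have "cmod (z - c) / d \<le> 1"
      using that assms by (simp add: dist_norm norm_minus_commute)
    then have "n z \<le> 0"
      unfolding nn using assms by (simp add: power_le_one)
    then show ?thesis
      by (simp add: g_def possq_def)
  qed
  have 3: "g (n z) = 1" if "z \<notin> ball c (2*d)" for z
  proof -
    have "cmod (z - c) / d \<ge> 2"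
      using that assms by (simp add: dist_norm norm_minus_commute field_simps)
    then have "(cmod (z - c) / d)\<^sup>2 \<ge> 2\<^sup>2"
      by (rule power_mono) simp
    then have "n z \<ge> 1"
      unfolding nn by simp
    then have "possq (n z) \<ge> 1"
      unfolding possq_def by simp
    then show ?thesis
      by (simp add: g_def possq_def)
  qed
  show ?thesis
    using 1 2 3 by blast
qed

text \<open>The product of the cutoffs of the single balls has both properties.\<close>

lemma ex_bump_balls:
  assumes "finite I" "d > 0"
  shows "\<exists>u ux uy. has_partials u ux uy \<and> (\<forall>z\<in>(\<Union>c\<in>I. ball c d). u z = 0) \<and>
    (\<forall>z. z \<notin> (\<Union>c\<in>I. ball c (2*d)) \<longrightarrow> u z = (1::real))"
  using assms(1)
proof (induction I rule: finite_induct)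
  case empty
  show ?case
    using has_partials_const[of "1::real"] by fastforce
next
  case (insert c I)
  from insert.IH obtain u ux uy where u: "has_partials u ux uy" "\<And>z. z \<in> (\<Union>c\<in>I. ball c d) \<Longrightarrow> u z = 0"
    "\<And>z. z \<notin> (\<Union>c\<in>I. ball c (2*d)) \<Longrightarrow> u z = (1::real)"
    by blast
  from ex_bump_ball[OF assms(2), of c]
  obtain v vx vy where v: "has_partials v vx vy" "\<And>z. z \<in> ball c d \<Longrightarrow> v z = 0"
    "\<And>z. z \<notin> ball c (2*d) \<Longrightarrow> v z = (1::real)"
    by blast
  show ?case
  proof (rule exI, rule exI, rule exI, intro conjI ballI allI impI)
    show "has_partials (\<lambda>z. u z * v z) (\<lambda>z. u z * vx z + ux z * v z) (\<lambda>z. u z * vy z + uy z * v z)"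
      by (rule has_partials_mult[OF u(1) v(1)])
    show "u z * v z = 0" if "z \<in> (\<Union>c\<in>insert c I. ball c d)" for z
      using that u(2)[of z] v(2)[of z] by fastforce
    show "u z * v z = 1" if "z \<notin> (\<Union>c\<in>insert c I. ball c (2*d))" for z
      using that u(3)[of z] v(3)[of z] by auto
  qed
qed

lemma ex_cutoff:
  fixes K L :: "complex set"
  assumes K: "compact K" and L: "closed L" "K \<inter> L = {}"
  obtains u :: "complex \<Rightarrow> real" and ux uy U V R where
    "has_partials u ux uy" "open U" "K \<subseteq> U" "\<And>z. z \<in> U \<Longrightarrow> u z = 0"
    "open V" "L \<subseteq> V" "\<And>z. z \<in> V \<Longrightarrow> u z = 1" "\<And>z. cmod z > R \<Longrightarrow> z \<in> V"
proof -
  obtain e where e: "e > 0" "\<And>x y. x \<in> K \<Longrightarrow> y \<in> L \<Longrightarrow> e \<le> dist x y"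
    using separate_compact_closed[OF assms] by blast
  \<comment> \<open>The doubled balls have radius \<open>2 * e / 3\<close>, less than the distance
    \<open>e\<close> that separates their centres from \<open>L\<close>.\<close>
  define d where "d = e / 3"
  have d: "d > 0" using e by (simp add: d_def)
  obtain I where I: "I \<subseteq> K" "finite I" "K \<subseteq> (\<Union>c\<in>I. ball c d)"
    using compactE_image[OF K, of K "\<lambda>c. ball c d"] d
    by (metis UN_I centre_in_ball open_ball subsetI)
  obtain u ux uy where u: "has_partials u ux uy" "\<forall>z\<in>(\<Union>c\<in>I. ball c d). u z = 0"
    "\<forall>z. z \<notin> (\<Union>c\<in>I. ball c (2*d)) \<longrightarrow> u z = (1::real)"
    using ex_bump_balls[OF I(2) d] by blast
  \<comment> \<open>Closed balls make \<open>C\<close> compact: its complement is open, contains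
    \<open>L\<close> and all points of large modulus, and \<open>u\<close> is 1 on it.\<close>
  define C where "C = (\<Union>c\<in>I. cball c (2*d))"
  have C: "compact C"
    unfolding C_def using I(2) by (intro compact_UN) auto
  obtain R where R: "\<And>z. z \<in> C \<Longrightarrow> cmod z \<le> R"
    using compact_imp_bounded[OF C] by (auto simp: bounded_iff)
  have LC: "L \<subseteq> - C"
  proof
    fix z assume z: "z \<in> L"
    have "e \<le> dist c z" if "c \<in> I" for c
      using e(2) I(1) z that by blast
    then show "z \<in> - C"
      using d e(1) by (fastforce simp: C_def d_def)
  qed
  show thesis
  proof (rule that[of u ux uy "\<Union>c\<in>I. ball c d" "- C" R])
    show "open (- C)"
      using C compact_imp_closed by auto
    show "u z = 1" if "z \<in> - C" for z
    proof -
      have "z \<notin> (\<Union>c\<in>I. ball c (2*d))"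
        using that by (auto simp: C_def not_le)
      then show ?thesis
        using u(3) by blast
    qed
    show "z \<in> - C" if "R < cmod z" for z
      using that R by fastforce
  qed (use u I LC in auto)
qed

section \<open>A Cauchy--Pompeiu formula in polar coordinates\<close>

text \<open>The d-bar operator in polar form: for partials \<open>a\<close>, \<open>b\<close> at
  angle \<open>t\<close> and radius \<open>r\<close>, the two brackets are the radial derivative and
  \<open>1/r\<close> times the angular one.\<close>

lemma cis_scaleC_partials:
  "cis (- t) *\<^sub>C (a + \<i> *\<^sub>C b) =
    (cos t *\<^sub>R a + sin t *\<^sub>R b) + \<i> *\<^sub>C (- sin t *\<^sub>R a + cos t *\<^sub>R b)"
proof -
  have "cis (- t) *\<^sub>C (a + \<i> *\<^sub>C b) = (of_real (cos t) + - \<i> * of_real (sin t)) *\<^sub>C (a + \<i> *\<^sub>C b)"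
    by (rule arg_cong[where f="\<lambda>c. c *\<^sub>C _"]) (simp add: complex_eq_iff)
  also have "\<dots> = of_real (cos t) *\<^sub>C a + of_real (sin t) *\<^sub>C b
      + \<i> *\<^sub>C (of_real (- sin t) *\<^sub>C a + of_real (cos t) *\<^sub>C b)"
    by (simp add: scaleC.add_left scaleC.add_right scaleC.diff_left scaleC.diff_right scaleC_simps
        algebra_simps)
  finally show ?thesis
    by (simp add: scaleC_of_real scaleC.minus_left scaleC.minus_right)
qed

lemma rcis_scaleR: "rcis r t = r *\<^sub>R cis t"
  by (simp add: rcis_def scaleR_conv_of_real)

text \<open>
  The circle means of \<open>f\<close> can be differentiated under the integral; adding \<open>\<i>/r\<close> times the angular
  derivative, whose integral over a circle vanishes, turns the radial derivative of \<open>f\<close> into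
  \<open>e\<^sup>-\<^sup>i\<^sup>t (f\<^sub>x + \<i> f\<^sub>y)\<close>, which only sees the failure of holomorphy.
\<close>

lemma polar_Green:
  fixes f :: "complex \<Rightarrow> 'e::complex_banach"
  assumes f: "has_partials f fx fy" and R: "0 \<le> R"
  shows "((\<lambda>r. integral {0..2*pi} (\<lambda>t. cis (- t) *\<^sub>C (fx (rcis r t) + \<i> *\<^sub>C fy (rcis r t))))
    has_integral (integral {0..2*pi} (\<lambda>t. f (rcis R t)) - (2*pi) *\<^sub>R f 0)) {0..R}"
proof -
  define J where "J r = integral (cbox 0 (2*pi)) (\<lambda>t. f (rcis r t))" for r
  define D where "D r t = cos t *\<^sub>R fx (rcis r t) + sin t *\<^sub>R fy (rcis r t)" for r t
  define E where "E r t = - sin t *\<^sub>R fx (rcis r t) + cos t *\<^sub>R fy (rcis r t)" for r t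
  have cont: "continuous_on UNIV fx" "continuous_on UNIV fy" "continuous_on UNIV f"
    using f has_partials_continuous_on[OF f] by (auto simp: has_partials_def)
  note [continuous_intros] = continuous_on_compose2[OF cont(1)] continuous_on_compose2[OF cont(2)]
    continuous_on_compose2[OF cont(3)]
  have rD: "((\<lambda>r. f (rcis r t)) has_vector_derivative D r t) (at r)" for r t
  proof -
    have "((\<lambda>r. rcis r t) has_derivative (\<lambda>h. h *\<^sub>R cis t)) (at r)"
      unfolding rcis_scaleR by (auto intro!: derivative_eq_intros)
    from has_derivative_compose[OF this has_partials_derivative[OF f]] show ?thesis
      unfolding has_vector_derivative_def by (rule has_derivative_eq_rhs) (simp add: D_def fun_eq_iff algebra_simps)
  qed
  have tE: "((\<lambda>t. f (rcis r t)) has_vector_derivative r *\<^sub>R E r t) (at t)" for r t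
  proof -
    have "((\<lambda>t. rcis r t) has_derivative (\<lambda>h. h *\<^sub>R (r *\<^sub>R (\<i> * cis t)))) (at t)"
    proof -
      have "((\<lambda>t. cis t) has_derivative (\<lambda>h. h *\<^sub>R (\<i> * cis t))) (at t)"
        by (auto intro!: derivative_eq_intros)
      from has_derivative_scaleR_right[OF this, of r] show ?thesis
        by (simp add: rcis_scaleR mult.commute[of r])
    qed
    from has_derivative_compose[OF this has_partials_derivative[OF f]] show ?thesis
      unfolding has_vector_derivative_def by (rule has_derivative_eq_rhs) (simp add: E_def fun_eq_iff algebra_simps)
  qed
  have rc: "continuous_on S (\<lambda>x. rcis (a x) (b x))" if "continuous_on S a" "continuous_on S b"
    for S :: "'z::topological_space set" and a b
    unfolding rcis_def using that by (intro continuous_intros) auto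
  have J: "(J has_vector_derivative integral (cbox 0 (2*pi)) (D r)) (at r)" for r
    unfolding J_def D_def
    by (rule leibniz_rule_vector_derivative[where U=UNIV, OF rD[unfolded D_def]])
      (auto intro!: continuous_intros integrable_continuous_real rc simp: split_beta)
  \<comment> \<open>The circle closes up, so the angular derivative \<open>r *\<^sub>R E r t\<close>
    integrates to 0; cancelling \<open>r\<close> uses \<open>r > 0\<close>.\<close>
  have E0: "(E r has_integral 0) {0..2*pi}" if "r > 0" for r
  proof -
    have "((\<lambda>t. r *\<^sub>R E r t) has_integral (f (rcis r (2*pi)) - f (rcis r 0))) {0..2*pi}"
      by (rule fundamental_theorem_of_calculus[OF _ has_vector_derivative_at_within[OF tE]]) simp
    then have "((\<lambda>t. r *\<^sub>R E r t) has_integral 0) {0..2*pi}"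
      by (simp add: rcis_def)
    from has_integral_cmul[OF this, of "inverse r"] show ?thesis
      using that by simp
  qed
  have inner: "integral (cbox 0 (2*pi)) (D r) =
      integral {0..2*pi} (\<lambda>t. cis (- t) *\<^sub>C (fx (rcis r t) + \<i> *\<^sub>C fy (rcis r t)))" if "r > 0" for r
  proof -
    have "(\<lambda>t. D r t) integrable_on {0..2*pi}"
      unfolding D_def by (intro integrable_continuous_real continuous_intros rc) auto
    moreover have "((\<lambda>t. \<i> *\<^sub>C E r t) has_integral 0) {0..2*pi}"
      using has_integral_linear[OF E0[OF that] scaleC.bounded_linear_right[of \<i>]]
      by (simp add: o_def scaleC_simps)
    ultimately have "((\<lambda>t. D r t + \<i> *\<^sub>C E r t) has_integral integral {0..2*pi} (D r) + 0) {0..2*pi}"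
      by (intro has_integral_add integrable_integral)
    then show ?thesis
      by (simp add: cis_scaleC_partials D_def E_def integral_unique)
  qed
  have "((\<lambda>r. integral {0..2*pi} (\<lambda>t. cis (- t) *\<^sub>C (fx (rcis r t) + \<i> *\<^sub>C fy (rcis r t))))
      has_integral (J R - J 0)) {0..R}"
  \<comment> \<open>\<open>inner\<close> is established for \<open>r > 0\<close>, so the derivative
    is supplied on the open interval and the endpoint 0 is handled by continuity of
    \<open>J\<close>.\<close>
  proof (rule fundamental_theorem_of_calculus_interior[OF R])
    show "continuous_on {0..R} J"
      using has_vector_derivative_continuous[OF J] by (simp add: continuous_at_imp_continuous_on)
    show "(J has_vector_derivative
        integral {0..2*pi} (\<lambda>t. cis (- t) *\<^sub>C (fx (rcis r t) + \<i> *\<^sub>C fy (rcis r t)))) (at r)"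
      if "r \<in> {0<..<R}" for r
      using J[of r] inner[of r] that by simp
  qed
  moreover have "J 0 = (2*pi) *\<^sub>R f 0"
    by (simp add: J_def)
  ultimately show ?thesis
    by (simp add: J_def)
qed

text \<open>Extension by zero: \<open>N\<close> and \<open>U\<close> are open and cover the plane,
  the product vanishes on \<open>N\<close> whatever \<open>G\<close> is there, and the product rule
  applies on \<open>U\<close>. By complex differentiability the partials of \<open>G\<close> are
  \<open>G'\<close> and \<open>\<i> *\<^sub>C G'\<close>.\<close>

lemma has_partials_cutoff:
  fixes u :: "complex \<Rightarrow> real" and G :: "complex \<Rightarrow> 'e::complex_banach"
  assumes u: "has_partials u ux uy" and N: "open N" "\<And>z. z \<in> N \<Longrightarrow> u z = 0"
    and U: "open U" "N \<union> U = UNIV"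
    and G: "\<And>z. z \<in> U \<Longrightarrow> (G has_derivative (\<lambda>h. h *\<^sub>C G' z)) (at z)" and G': "continuous_on U G'"
  shows "has_partials (\<lambda>z. u z *\<^sub>R G z) (\<lambda>z. ux z *\<^sub>R G z + u z *\<^sub>R G' z)
     (\<lambda>z. uy z *\<^sub>R G z + u z *\<^sub>R (\<i> *\<^sub>C G' z))"
proof -
  have z: "ux z = 0" "uy z = 0" if "z \<in> N" for z
    using has_partials_const_on_open[OF u N(1) that N(2)] by auto
  have cu: "continuous_on U u" "continuous_on U ux" "continuous_on U uy"
    using u has_partials_continuous_on[OF u] by (auto simp: has_partials_def intro: continuous_on_subset)
  have cG: "continuous_on U G"
    using has_derivative_continuous[OF G] by (simp add: continuous_at_imp_continuous_on)
  have glue: "continuous_on UNIV k" if "\<And>z. z \<in> N \<Longrightarrow> k z = 0" "continuous_on U k" for k :: "complex \<Rightarrow> 'e"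
  proof -
    have "continuous_on N k"
      using that(1) by (simp cong: continuous_on_cong)
    then show ?thesis
      using continuous_on_open_Un[OF N(1) U(1) _ that(2)] U(2) by simp
  qed
  have "continuous_on UNIV (\<lambda>z. ux z *\<^sub>R G z + u z *\<^sub>R G' z)"
    by (rule glue) (auto simp: z N(2) intro!: continuous_intros cu cG G')
  moreover have "continuous_on UNIV (\<lambda>z. uy z *\<^sub>R G z + u z *\<^sub>R (\<i> *\<^sub>C G' z))"
    by (rule glue) (auto simp: z N(2) intro!: continuous_intros cu cG G' scaleC.continuous_on)
  moreover have "((\<lambda>z. u z *\<^sub>R G z) has_derivative
     (\<lambda>h. Re h *\<^sub>R (ux z *\<^sub>R G z + u z *\<^sub>R G' z) + Im h *\<^sub>R (uy z *\<^sub>R G z + u z *\<^sub>R (\<i> *\<^sub>C G' z)))) (at z)" for z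
  proof (cases "z \<in> N")
    case True
    have "((\<lambda>z. u z *\<^sub>R G z) has_derivative (\<lambda>h. 0)) (at z)"
      by (rule has_derivative_transform_within_open[OF has_derivative_const[of 0] N(1) True])
        (simp add: N(2))
    then show ?thesis
      by (simp add: z N(2) True)
  next
    case False
    then have zU: "z \<in> U" using U(2) by blast
    have h: "h *\<^sub>C y = Re h *\<^sub>R y + Im h *\<^sub>R (\<i> *\<^sub>C y)" for h and y :: 'e
    proof -
      have "h *\<^sub>C y = (of_real (Re h) + of_real (Im h) * \<i>) *\<^sub>C y"
        by (rule arg_cong[where f="\<lambda>c. c *\<^sub>C _"]) (simp add: complex_eq_iff)
      then show ?thesis
        by (simp add: scaleC.add_left flip: scaleC_of_real scaleC_scaleC)
    qed
    have "(\<lambda>h. u z *\<^sub>R (h *\<^sub>C G' z) + (Re h *\<^sub>R ux z + Im h *\<^sub>R uy z) *\<^sub>R G z) =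
      (\<lambda>h. Re h *\<^sub>R (ux z *\<^sub>R G z + u z *\<^sub>R G' z) + Im h *\<^sub>R (uy z *\<^sub>R G z + u z *\<^sub>R (\<i> *\<^sub>C G' z)))"
      (is "?l = ?r")
    proof
      fix h
      show "?l h = ?r h"
        by (subst h[of h "G' z"]) (simp add: algebra_simps)
    qed
    then show ?thesis
      using has_derivative_scaleR[OF has_partials_derivative[OF u] G[OF zU]] by simp
  qed
  ultimately show ?thesis
    by (simp add: has_partials_def)
qed

section \<open>Resolvents\<close>

abbreviation clinear_blinfun :: "('a::complex_normed_vector \<Rightarrow>\<^sub>L 'b::complex_normed_vector) \<Rightarrow> bool" where
  "clinear_blinfun f \<equiv> \<forall>c x. blinfun_apply f (c *\<^sub>C x) = c *\<^sub>C blinfun_apply f x"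

lemma blinfun_compose_scaleC:
  "clinear_blinfun f \<Longrightarrow> f o\<^sub>L (c *\<^sub>C g) = c *\<^sub>C (f o\<^sub>L g)"
  by (rule blinfun_eqI) (simp add: blinfun_apply_scaleC)

lemma blinfun_compose_assoc: "(f o\<^sub>L g) o\<^sub>L h = f o\<^sub>L (g o\<^sub>L h)"
  by (rule blinfun_eqI) simp

text \<open>A right inverse \<open>V\<close> and a left inverse \<open>W\<close> are the fixed
  points of the contractions sending \<open>X\<close> to \<open>1 + K X\<close> and to
  \<open>1 + X K\<close>; associativity makes them equal. Taking norms in \<open>V = 1 + K V\<close>
  gives the bound.\<close>

lemma Neumann:
  fixes K :: "'a::banach \<Rightarrow>\<^sub>L 'a"
  assumes "norm K < 1"
  obtains V where "(id_blinfun - K) o\<^sub>L V = id_blinfun" "V o\<^sub>L (id_blinfun - K) = id_blinfun"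
    "norm V \<le> 1 / (1 - norm K)"
proof -
  interpret c: bounded_bilinear "(o\<^sub>L) :: ('a \<Rightarrow>\<^sub>L 'a) \<Rightarrow> ('a \<Rightarrow>\<^sub>L 'a) \<Rightarrow> ('a \<Rightarrow>\<^sub>L 'a)"
    by (rule bounded_bilinear_blinfun_compose)
  have "\<exists>!V. id_blinfun + (K o\<^sub>L V) = V"
    by (rule banach_fix_type[of "norm K"])
      (auto simp: assms dist_norm norm_blinfun_compose simp flip: c.diff_right)
  then obtain V where V: "id_blinfun + (K o\<^sub>L V) = V" by blast
  have "\<exists>!W. id_blinfun + (W o\<^sub>L K) = W"
    by (rule banach_fix_type[of "norm K"])
      (auto simp: assms dist_norm simp flip: c.diff_left intro: order_trans[OF norm_blinfun_compose] simp: mult.commute)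
  then obtain W where W: "id_blinfun + (W o\<^sub>L K) = W" by blast
  have id: "f o\<^sub>L id_blinfun = f" "id_blinfun o\<^sub>L f = f" for f :: "'a \<Rightarrow>\<^sub>L 'a"
    by (rule blinfun_eqI, simp)+
  have V1: "V - (K o\<^sub>L V) = id_blinfun" and W1: "W - (W o\<^sub>L K) = id_blinfun"
    using V W by (metis add_diff_cancel_right')+
  have "W = W o\<^sub>L (V - (K o\<^sub>L V))"
    by (simp add: V1 id)
  also have "\<dots> = (W - (W o\<^sub>L K)) o\<^sub>L V"
    by (simp add: c.diff_right c.diff_left blinfun_compose_assoc)
  finally have "W = V"
    by (simp add: W1 id)
  have "norm V \<le> norm (id_blinfun :: 'a \<Rightarrow>\<^sub>L 'a) + norm (K o\<^sub>L V)"
    using norm_triangle_ineq[of id_blinfun "K o\<^sub>L V"] V by simp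
  also have "\<dots> \<le> 1 + norm K * norm V"
    by (intro add_mono norm_blinfun_id_le norm_blinfun_compose)
  finally have "norm V \<le> 1 / (1 - norm K)"
    using assms by (simp add: field_simps)
  with V1 W1 \<open>W = V\<close> show thesis
    by (intro that[of V]) (simp_all add: c.diff_left c.diff_right id)
qed

text \<open>The convention is the inverse of \<open>P - z\<close>, which fixes the signs below. The
  inverse is a priori just real-linear; \<open>is_resolvent_clinear\<close> supplies complex
  linearity.\<close>

definition is_resolvent :: "('a::complex_banach \<Rightarrow>\<^sub>L 'a) \<Rightarrow> complex \<Rightarrow> ('a \<Rightarrow>\<^sub>L 'a) \<Rightarrow> bool" where
  "is_resolvent P z U \<longleftrightarrow> (P - z *\<^sub>C id_blinfun) o\<^sub>L U = id_blinfun \<and> U o\<^sub>L (P - z *\<^sub>C id_blinfun) = id_blinfun"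

definition resolvent_set :: "('a::complex_banach \<Rightarrow>\<^sub>L 'a) \<Rightarrow> complex set" where
  "resolvent_set P = {z. \<exists>U. is_resolvent P z U}"

text \<open>Off the resolvent set the value is unspecified; in the integrals below it is always
  multiplied by a factor that vanishes there.\<close>

definition resolvent :: "('a::complex_banach \<Rightarrow>\<^sub>L 'a) \<Rightarrow> complex \<Rightarrow> ('a \<Rightarrow>\<^sub>L 'a)" where
  "resolvent P z = (SOME U. is_resolvent P z U)"

lemma is_resolvent_iff:
  "is_resolvent P z U \<longleftrightarrow> (\<forall>x. P (U x) - z *\<^sub>C U x = x) \<and> (\<forall>x. U (P x - z *\<^sub>C x) = x)"
  unfolding is_resolvent_def
  by (auto simp: blinfun_apply_inject[symmetric] fun_eq_iff blinfun.diff_left blinfun_apply_scaleC)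

lemma is_resolvent_resolvent: "z \<in> resolvent_set P \<Longrightarrow> is_resolvent P z (resolvent P z)"
  unfolding resolvent_set_def resolvent_def by (auto intro: someI)

lemma is_resolvent_unique: "is_resolvent P z U \<Longrightarrow> is_resolvent P z V \<Longrightarrow> U = V"
  by (rule blinfun_eqI) (metis is_resolvent_iff)

lemma resolvent_eqI:
  assumes "is_resolvent P z U"
  shows "z \<in> resolvent_set P" "resolvent P z = U"
proof -
  show z: "z \<in> resolvent_set P"
    using assms by (auto simp: resolvent_set_def)
  show "resolvent P z = U"
    by (rule is_resolvent_unique[OF is_resolvent_resolvent[OF z] assms])
qed

text \<open>Since \<open>P - z\<close> is complex linear, \<open>c *\<^sub>C x\<close> is its value
  at \<open>c *\<^sub>C U x\<close>; applying \<open>U\<close> recovers that vector.\<close>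

lemma is_resolvent_clinear:
  assumes P: "clinear_blinfun P" and U: "is_resolvent P z U"
  shows "clinear_blinfun U"
proof (intro allI)
  fix c x
  have "U (c *\<^sub>C x) = U (c *\<^sub>C (P (U x) - z *\<^sub>C U x))"
    using U by (simp add: is_resolvent_iff)
  also have "c *\<^sub>C (P (U x) - z *\<^sub>C U x) = P (c *\<^sub>C U x) - z *\<^sub>C c *\<^sub>C U x"
    by (simp add: P scaleC.diff_right scaleC_scaleC mult.commute)
  also have "U \<dots> = c *\<^sub>C U x"
    using U by (simp add: is_resolvent_iff)
  finally show "U (c *\<^sub>C x) = c *\<^sub>C U x" .
qed

lemmas resolvent_clinear = is_resolvent_clinear[OF _ is_resolvent_resolvent]

lemma blinfun_apply_resolvent:
  assumes "z \<in> resolvent_set P"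
  shows "P (resolvent P z x) = x + z *\<^sub>C resolvent P z x"
  using is_resolvent_resolvent[OF assms] by (simp add: is_resolvent_iff diff_eq_eq)

lemma resolvent_blinfun_apply:
  assumes "clinear_blinfun P" "z \<in> resolvent_set P"
  shows "resolvent P z (P x) = x + z *\<^sub>C resolvent P z x"
  using is_resolvent_resolvent[OF assms(2)] resolvent_clinear[OF assms]
  by (simp add: is_resolvent_iff diff_eq_eq blinfun.diff_right)

text \<open>With \<open>y = resolvent P w x\<close>, write \<open>x = (P - z) y + (z - w) y\<close>
  and apply the resolvent at \<open>z\<close>.\<close>

lemma resolvent_identity:
  assumes P: "clinear_blinfun P" and z: "z \<in> resolvent_set P" and w: "w \<in> resolvent_set P"
  shows "resolvent P z - resolvent P w = (z - w) *\<^sub>C (resolvent P z o\<^sub>L resolvent P w)"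
proof (rule blinfun_eqI)
  fix x
  define y where "y = resolvent P w x"
  have x: "x = P y - w *\<^sub>C y"
    using blinfun_apply_resolvent[OF w, of x] by (simp add: y_def)
  have "resolvent P z x = y + (z - w) *\<^sub>C resolvent P z y"
    unfolding x using resolvent_clinear[OF P z]
    by (simp add: blinfun.diff_right resolvent_blinfun_apply[OF P z] scaleC.diff_left)
  then show "blinfun_apply (resolvent P z - resolvent P w) x
    = blinfun_apply ((z - w) *\<^sub>C (resolvent P z o\<^sub>L resolvent P w)) x"
    by (simp add: blinfun.diff_left blinfun_apply_scaleC y_def)
qed

text \<open>\<open>P - w = (1 - K) (P - z)\<close> with \<open>K = (w - z) R\<close>, so the inverse
  is \<open>R\<close> times a Neumann inverse. The threshold 1/2 bounds the latter by 2, a locally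
  uniform bound that the differentiability proof relies on.\<close>

lemma is_resolvent_perturb:
  assumes P: "clinear_blinfun P" and z: "z \<in> resolvent_set P"
    and w: "cmod (w - z) * norm (resolvent P z) \<le> 1/2"
  shows "w \<in> resolvent_set P" "norm (resolvent P w) \<le> 2 * norm (resolvent P z)"
proof -
  define R where "R = resolvent P z"
  define K where "K = (w - z) *\<^sub>C R"
  have nK: "norm K \<le> 1/2"
    using w by (simp add: K_def R_def norm_scaleC)
  have "norm K < 1"
    using nK by simp
  from Neumann[OF this] obtain V where V: "(id_blinfun - K) o\<^sub>L V = id_blinfun"
    "V o\<^sub>L (id_blinfun - K) = id_blinfun" "norm V \<le> 1 / (1 - norm K)"
    by blast
  have V1: "V x - K (V x) = x" "V (x - K x) = x" for x
    using arg_cong[OF V(1), of "\<lambda>f. blinfun_apply f x"] arg_cong[OF V(2), of "\<lambda>f. blinfun_apply f x"]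
    by (simp_all add: blinfun.diff_left)
  have U: "is_resolvent P w (R o\<^sub>L V)"
    unfolding is_resolvent_iff
  proof (intro conjI allI)
    fix x
    have "P (R (V x)) - w *\<^sub>C R (V x) = V x - K (V x)"
      using blinfun_apply_resolvent[OF z, of "V x"]
      by (simp add: K_def R_def blinfun_apply_scaleC scaleC.diff_left[of w z "resolvent P z (V x)"]
          del: blinfun_apply_blinfun_compose)
    then show "P ((R o\<^sub>L V) x) - w *\<^sub>C (R o\<^sub>L V) x = x"
      using V1 by simp
    define y where "y = P x - z *\<^sub>C x"
    have Ry: "R y = x"
      using is_resolvent_resolvent[OF z] by (simp add: is_resolvent_iff R_def y_def)
    moreover have "K y = (w - z) *\<^sub>C R y"
      unfolding K_def by (rule blinfun_apply_scaleC)
    ultimately have "P x - w *\<^sub>C x = y - K y"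
      by (simp add: y_def scaleC.diff_left)
    then show "(R o\<^sub>L V) (P x - w *\<^sub>C x) = x"
      using V1(2)[of y] Ry by simp
  qed
  then show "w \<in> resolvent_set P"
    by (rule resolvent_eqI)
  have "1 / (1 - norm K) \<le> 2"
    using nK by (simp add: field_simps)
  then have "norm V \<le> 2"
    using V(3) by simp
  then have "norm R * norm V \<le> norm R * 2"
    by (rule mult_left_mono) simp
  then show "norm (resolvent P w) \<le> 2 * norm (resolvent P z)"
    using norm_blinfun_compose[of R V] resolvent_eqI(2)[OF U] by (simp add: R_def)
qed

lemma open_resolvent_set:
  assumes P: "clinear_blinfun P"
  shows "open (resolvent_set P)"
  unfolding open_dist
proof (intro ballI)
  fix z assume z: "z \<in> resolvent_set P"
  \<comment> \<open>The added 1 keeps the denominator positive even if the resolvent is the zero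
    operator, as on the zero space.\<close>
  define e where "e = 1 / (2 * (norm (resolvent P z) + 1))"
  have "e > 0"
    by (simp add: e_def add_nonneg_pos)
  moreover have "w \<in> resolvent_set P" if "dist w z < e" for w
  proof (rule is_resolvent_perturb(1)[OF P z])
    have "cmod (w - z) * norm (resolvent P z) \<le> e * (norm (resolvent P z) + 1)"
      using that by (intro mult_mono) (auto simp: dist_norm e_def)
    also have "\<dots> = 1/2"
    proof -
      have "norm (resolvent P z) + 1 \<noteq> 0"
        using norm_ge_zero[of "resolvent P z"] by linarith
      then show ?thesis
        by (simp add: e_def)
    qed
    finally show "cmod (w - z) * norm (resolvent P z) \<le> 1/2" .
  qed
  ultimately show "\<exists>e>0. \<forall>w. dist w z < e \<longrightarrow> w \<in> resolvent_set P"
    by blast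
qed

lemma eventually_resolvent_bound:
  assumes P: "clinear_blinfun P" and z: "z \<in> resolvent_set P"
  shows "\<forall>\<^sub>F w in at z. w \<in> resolvent_set P \<and> norm (resolvent P w) \<le> 2 * norm (resolvent P z)"
proof -
  have "((\<lambda>w. cmod (w - z) * norm (resolvent P z)) \<longlongrightarrow> cmod (z - z) * norm (resolvent P z)) (at z)"
    by (intro tendsto_intros)
  then have "\<forall>\<^sub>F w in at z. cmod (w - z) * norm (resolvent P z) < 1/2"
    by (rule order_tendstoD) simp
  then show ?thesis
    by eventually_elim (use is_resolvent_perturb[OF P z] in auto)
qed

text \<open>Two uses of the resolvent identity turn the remainder into
  \<open>(w - z)^2 S R R\<close>, where \<open>S\<close> is the resolvent at \<open>w\<close>; the
  local bound \<open>2 * M\<close> on \<open>S\<close> makes it \<open>o(w - z)\<close>.\<close>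

lemma has_derivative_resolvent:
  assumes P: "clinear_blinfun P" and z: "z \<in> resolvent_set P"
  shows "(resolvent P has_derivative (\<lambda>h. h *\<^sub>C (resolvent P z o\<^sub>L resolvent P z))) (at z)"
proof -
  interpret c: bounded_bilinear "(o\<^sub>L) :: ('a \<Rightarrow>\<^sub>L 'a) \<Rightarrow> ('a \<Rightarrow>\<^sub>L 'a) \<Rightarrow> ('a \<Rightarrow>\<^sub>L 'a)"
    by (rule bounded_bilinear_blinfun_compose)
  define R where "R = resolvent P z"
  define M where "M = norm R"
  obtain e where e: "e > 0" "\<And>w. w \<noteq> z \<Longrightarrow> dist w z < e \<Longrightarrow> w \<in> resolvent_set P \<and> norm (resolvent P w) \<le> 2 * M"
    using eventually_resolvent_bound[OF P z] unfolding eventually_at M_def R_def by blast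
  show ?thesis
    unfolding R_def[symmetric]
  proof (rule has_derivativeI_sandwich[OF e(1), where H="\<lambda>w. cmod (w - z) * (2 * M * (M * M))"])
    show "bounded_linear (\<lambda>h. h *\<^sub>C (R o\<^sub>L R))"
      by (rule scaleC.bounded_linear_left)
    have "((\<lambda>w. cmod (w - z) * (2 * M * (M * M))) \<longlongrightarrow> cmod (z - z) * (2 * M * (M * M))) (at z)"
      by (intro tendsto_intros)
    then show "((\<lambda>w. cmod (w - z) * (2 * M * (M * M))) \<longlongrightarrow> 0) (at z)"
      by simp
    fix w assume w: "w \<noteq> z" "dist w z < e"
    define S where "S = resolvent P w"
    have wr: "w \<in> resolvent_set P" "norm S \<le> 2 * M"
      using e(2)[OF w] by (auto simp: S_def)
    have SR: "S - R = (w - z) *\<^sub>C (S o\<^sub>L R)"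
      unfolding S_def R_def by (rule resolvent_identity[OF P wr(1) z])
    then have "S - R - (w - z) *\<^sub>C (R o\<^sub>L R) = (w - z) *\<^sub>C ((S - R) o\<^sub>L R)"
      by (metis scaleC.diff_right c.diff_left)
    also have "\<dots> = ((w - z) * (w - z)) *\<^sub>C (S o\<^sub>L (R o\<^sub>L R))"
      unfolding SR by (simp add: scaleC_blinfun_compose scaleC_scaleC blinfun_compose_assoc)
    finally have "norm (S - R - (w - z) *\<^sub>C (R o\<^sub>L R)) = cmod (w - z) * cmod (w - z) * norm (S o\<^sub>L (R o\<^sub>L R))"
      by (simp add: norm_scaleC norm_mult)
    moreover have "norm (S o\<^sub>L (R o\<^sub>L R)) \<le> 2 * M * (M * M)"
      by (rule order_trans[OF norm_blinfun_compose])
        (intro mult_mono wr norm_blinfun_compose order_trans[OF norm_blinfun_compose], auto simp: M_def)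
    ultimately show "norm (resolvent P w - resolvent P z - (w - z) *\<^sub>C (R o\<^sub>L R)) / norm (w - z)
        \<le> cmod (w - z) * (2 * M * (M * M))"
      using w(1) by (auto simp: S_def R_def[symmetric] divide_simps intro: mult_left_mono)
  qed
qed

lemma continuous_on_resolvent:
  assumes P: "clinear_blinfun P"
  shows "continuous_on (resolvent_set P) (resolvent P)"
  using has_derivative_continuous[OF has_derivative_resolvent[OF P]]
  by (simp add: continuous_at_imp_continuous_on)

lemma outside_norm_resolvent:
  fixes P :: "'a::complex_banach \<Rightarrow>\<^sub>L 'a"
  assumes P: "clinear_blinfun P" and z: "norm P < cmod z"
  shows "z \<in> resolvent_set P" "norm (resolvent P z) \<le> 1 / (cmod z - norm P)"
proof -
  have z0: "z \<noteq> 0"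
    using z by auto
  define K where "K = inverse z *\<^sub>C P"
  have "norm K < 1"
  proof -
    have "norm K = norm P / cmod z"
      by (simp add: K_def norm_scaleC norm_inverse divide_inverse mult.commute)
    then show ?thesis
      using z z0 by simp
  qed
  from Neumann[OF this] obtain V where V: "(id_blinfun - K) o\<^sub>L V = id_blinfun"
    "V o\<^sub>L (id_blinfun - K) = id_blinfun"
    by blast
  have V1: "V x - K (V x) = x" "V (x - K x) = x" for x
    using arg_cong[OF V(1), of "\<lambda>f. blinfun_apply f x"] arg_cong[OF V(2), of "\<lambda>f. blinfun_apply f x"]
    by (simp_all add: blinfun.diff_left)
  have zK: "z *\<^sub>C K x = P x" for x
    using z0 by (simp add: K_def blinfun_apply_scaleC scaleC_scaleC scaleC_one)
  have "is_resolvent P z ((- inverse z) *\<^sub>C V)"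
    unfolding is_resolvent_iff
  proof (intro conjI allI)
    fix x
    have "P (inverse z *\<^sub>C V x) = K (V x)"
      using P by (simp add: K_def blinfun_apply_scaleC)
    then show "P ((- inverse z *\<^sub>C V) x) - z *\<^sub>C (- inverse z *\<^sub>C V) x = x"
      using z0 V1(1)[of x]
      by (simp add: blinfun_apply_scaleC scaleC_simps blinfun.minus_right blinfun.minus_left)
    \<comment> \<open>\<open>Neumann\<close> yields just a real-linear \<open>V\<close>; homogeneity
      follows because \<open>1 - K\<close> sends \<open>c *\<^sub>C V y\<close> to
      \<open>c *\<^sub>C y\<close>.\<close>
    have cV: "V (c *\<^sub>C y) = c *\<^sub>C V y" for c y
    proof -
      have "K (c *\<^sub>C V y) = c *\<^sub>C K (V y)"
        using P by (simp add: K_def blinfun_apply_scaleC scaleC_scaleC mult.commute)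
      then have "c *\<^sub>C V y - K (c *\<^sub>C V y) = c *\<^sub>C y"
        using V1(1)[of y] by (simp flip: scaleC.diff_right)
      then show ?thesis
        using V1(2)[of "c *\<^sub>C V y"] by simp
    qed
    have "P x - z *\<^sub>C x = (- z) *\<^sub>C (x - K x)"
      by (simp add: scaleC.diff_right zK scaleC_simps)
    then show "(- inverse z *\<^sub>C V) (P x - z *\<^sub>C x) = x"
      using V1(2)[of x] z0 by (simp add: blinfun_apply_scaleC cV scaleC_simps blinfun.minus_left blinfun.minus_right)
  qed
  then show zr: "z \<in> resolvent_set P"
    by (rule resolvent_eqI)
  define R where "R = resolvent P z"
  \<comment> \<open>Taking norms in this identity gives
    \<open>cmod z * norm R \<le> norm P * norm R + 1\<close>, hence the bound.\<close>
  have "z *\<^sub>C R = (P o\<^sub>L R) - id_blinfun"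
    by (rule blinfun_eqI)
      (simp add: blinfun_apply_scaleC blinfun.diff_left R_def blinfun_apply_resolvent[OF zr])
  then have "cmod z * norm R = norm ((P o\<^sub>L R) - id_blinfun)"
    by (metis norm_scaleC)
  also have "\<dots> \<le> norm P * norm R + 1"
    by (rule order_trans[OF norm_triangle_ineq4 add_mono[OF norm_blinfun_compose norm_blinfun_id_le]])
  finally show "norm (resolvent P z) \<le> 1 / (cmod z - norm P)"
    using z by (simp add: R_def field_simps)
qed

lemma compact_Compl_resolvent_set:
  assumes "clinear_blinfun P"
  shows "compact (- resolvent_set P)"
proof -
  have "- resolvent_set P \<subseteq> cball 0 (norm P)"
    using outside_norm_resolvent(1)[OF assms] by (force simp: not_le[symmetric])
  then show ?thesis
    using open_resolvent_set[OF assms] bounded_subset[OF bounded_cball]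
    by (simp add: compact_eq_bounded_closed closed_def) blast
qed

section \<open>The Sylvester equation\<close>

text \<open>\<open>P\<close> times its resolvent and the resolvent of \<open>Q\<close> times
  \<open>Q\<close> both have the form \<open>1 + z R\<close>, so the two terms
  \<open>z *\<^sub>C K\<close> cancel.\<close>

lemma resolvent_intertwine:
  assumes P: "clinear_blinfun P" and Q: "clinear_blinfun Q" and Z: "clinear_blinfun Z"
    and z: "z \<in> resolvent_set P" "z \<in> resolvent_set Q"
  defines "K \<equiv> resolvent P z o\<^sub>L Z o\<^sub>L resolvent Q z"
  shows "(P o\<^sub>L K) - (K o\<^sub>L Q) = (Z o\<^sub>L resolvent Q z) - (resolvent P z o\<^sub>L Z)"
proof (rule blinfun_eqI)
  fix x
  have "blinfun_apply (P o\<^sub>L K) x = Z (resolvent Q z x) + z *\<^sub>C K x"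
    by (simp add: K_def blinfun_apply_resolvent[OF z(1)])
  moreover have "blinfun_apply (K o\<^sub>L Q) x = resolvent P z (Z x) + z *\<^sub>C K x"
    using resolvent_clinear[OF P z(1)] Z
    by (simp add: K_def resolvent_blinfun_apply[OF Q z(2)] blinfun.add_right)
  ultimately show "blinfun_apply ((P o\<^sub>L K) - (K o\<^sub>L Q)) x =
      blinfun_apply ((Z o\<^sub>L resolvent Q z) - (resolvent P z o\<^sub>L Z)) x"
    by (simp add: blinfun.diff_left)
qed

text \<open>From \<open>z R = P R - 1\<close> the integrand plus \<open>Z\<close> equals
  \<open>P R Z\<close>, of order \<open>1 / (r - norm P)\<close>. Hence the circle integral tends to
  \<open>-2 pi Z\<close> as \<open>r\<close> grows.\<close>

lemma circle_integral_resolvent_bound: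
  fixes P :: "'a::complex_banach \<Rightarrow>\<^sub>L 'a" and Z :: "'b::complex_banach \<Rightarrow>\<^sub>L 'a"
  assumes P: "clinear_blinfun P" and r: "norm P < r"
  shows "norm (integral {0..2*pi} (\<lambda>t. rcis r t *\<^sub>C (resolvent P (rcis r t) o\<^sub>L Z)) + (2*pi) *\<^sub>R Z)
    \<le> 2 * pi * (norm P * norm Z) / (r - norm P)"
proof -
  define h where "h t = rcis r t *\<^sub>C (resolvent P (rcis r t) o\<^sub>L Z)" for t
  have r0: "r > 0" using r norm_ge_zero[of P] by linarith
  have cm: "cmod (rcis r t) = r" for t using r0 by simp
  have mem: "rcis r t \<in> resolvent_set P" and nb: "norm (resolvent P (rcis r t)) \<le> 1 / (r - norm P)" for t
    using outside_norm_resolvent[OF P, of "rcis r t"] r cm by auto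
  have rc: "continuous_on {0..2*pi} (\<lambda>t. rcis r t)"
    unfolding rcis_def by (intro continuous_intros)
  have "continuous_on {0..2*pi} (\<lambda>t. resolvent P (rcis r t))"
    by (rule continuous_on_compose2[OF continuous_on_resolvent[OF P] rc]) (use mem in auto)
  then have ch: "continuous_on {0..2*pi} h"
    unfolding h_def
    by (intro scaleC.continuous_on rc bounded_bilinear.continuous_on[OF bounded_bilinear_blinfun_compose]
        continuous_on_const)
  have eq: "h t + Z = P o\<^sub>L (resolvent P (rcis r t) o\<^sub>L Z)" for t
    by (rule blinfun_eqI)
      (simp add: h_def blinfun.add_left blinfun_apply_scaleC blinfun_apply_resolvent[OF mem])
  have "((\<lambda>t. h t + Z) has_integral (integral {0..2*pi} h + (2*pi) *\<^sub>R Z)) {0..2*pi}"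
    using has_integral_const_real[of Z 0 "2*pi"]
    by (intro has_integral_add integrable_integral integrable_continuous_real ch) simp
  moreover have "norm (h t + Z) \<le> (norm P * norm Z) / (r - norm P)" for t
  proof -
    have "norm (h t + Z) \<le> norm P * (norm (resolvent P (rcis r t)) * norm Z)"
      unfolding eq
      by (rule order_trans[OF norm_blinfun_compose mult_left_mono[OF norm_blinfun_compose]]) simp
    also have "\<dots> \<le> norm P * (1 / (r - norm P) * norm Z)"
      by (intro mult_left_mono mult_right_mono nb) auto
    finally show ?thesis by simp
  qed
  ultimately have "norm (integral {0..2*pi} h + (2*pi) *\<^sub>R Z)
      \<le> (norm P * norm Z) / (r - norm P) * measure lborel (cbox 0 (2*pi))"
    using r by (intro has_integral_bound[where f="\<lambda>t. h t + Z"]) auto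
  then show ?thesis
    by (simp add: h_def[abs_def] mult_ac)
qed

text \<open>
  With a cutoff \<open>u\<close> that is 0 near the spectrum of \<open>P\<close> and 1 near that of \<open>Q\<close> and near infinity,
  \<open>polar_Green\<close> is applied to \<open>z (u R\<^sub>P(z) Z + (1 - u) Z R\<^sub>Q(z))\<close>, whose limit at infinity is \<open>-Z\<close>;
  \<open>w\<close> is \<open>u\<^sub>x + \<i> u\<^sub>y\<close>.
\<close>

lemma resolvent_splitting:
  fixes P :: "'a::complex_banach \<Rightarrow>\<^sub>L 'a" and Q :: "'b::complex_banach \<Rightarrow>\<^sub>L 'b"
  assumes P: "clinear_blinfun P" and Q: "clinear_blinfun Q"
    and disj: "- resolvent_set P \<inter> - resolvent_set Q = {}"
  obtains w :: "complex \<Rightarrow> complex" and N R where "continuous_on UNIV w" "open N"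
    "N \<union> (resolvent_set P \<inter> resolvent_set Q) = UNIV" "\<And>z. z \<in> N \<Longrightarrow> w z = 0" "0 \<le> R"
    "\<And>Z. clinear_blinfun Z \<Longrightarrow> ((\<lambda>r. integral {0..2*pi} (\<lambda>t. cis (- t) *\<^sub>C
      (w (rcis r t) * rcis r t) *\<^sub>C ((resolvent P (rcis r t) o\<^sub>L Z) - (Z o\<^sub>L resolvent Q (rcis r t)))))
      has_integral - (2*pi) *\<^sub>R Z) {0..R}"
proof -
  have "closed (- resolvent_set Q)"
    using compact_Compl_resolvent_set[OF Q] compact_imp_closed by blast
  from ex_cutoff[OF compact_Compl_resolvent_set[OF P] this disj]
  obtain u :: "complex \<Rightarrow> real" and ux uy U V R0 where u: "has_partials u ux uy"
    and U: "open U" "- resolvent_set P \<subseteq> U" "\<And>z. z \<in> U \<Longrightarrow> u z = 0"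
    and V: "open V" "- resolvent_set Q \<subseteq> V" "\<And>z. z \<in> V \<Longrightarrow> u z = 1" "\<And>z. cmod z > R0 \<Longrightarrow> z \<in> V"
    by blast
  define w where "w z = complex_of_real (ux z) + \<i> * complex_of_real (uy z)" for z
  define R where "R = max R0 0 + 1"
  have R: "R > R0" "R \<ge> 0" by (auto simp: R_def)
  have w0: "w z = 0" if "z \<in> U \<union> V" for z
    using that has_partials_const_on_open[OF u U(1) _ U(3), of z]
      has_partials_const_on_open[OF u V(1) _ V(3), of z]
    by (auto simp: w_def)
  have cw: "continuous_on UNIV w"
    using u unfolding w_def has_partials_def by (auto intro!: continuous_intros)
  show thesis
  proof (rule that[OF cw, of "U \<union> V" R])
    fix Z :: "'b \<Rightarrow>\<^sub>L 'a" assume Z: "clinear_blinfun Z"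
    define G where "G z = z *\<^sub>C (resolvent P z o\<^sub>L Z)" for z
    define G' where "G' z = z *\<^sub>C (resolvent P z o\<^sub>L resolvent P z o\<^sub>L Z) + (resolvent P z o\<^sub>L Z)" for z
    define H where "H z = z *\<^sub>C (Z o\<^sub>L resolvent Q z)" for z
    define H' where "H' z = z *\<^sub>C (Z o\<^sub>L (resolvent Q z o\<^sub>L resolvent Q z)) + (Z o\<^sub>L resolvent Q z)" for z
    have dG: "(G has_derivative (\<lambda>h. h *\<^sub>C G' z)) (at z)" if "z \<in> resolvent_set P" for z
      unfolding G_def
      by (rule has_derivative_eq_rhs[OF scaleC.FDERIV[OF has_derivative_ident
            bounded_bilinear.FDERIV[OF bounded_bilinear_blinfun_compose
              has_derivative_resolvent[OF P that] has_derivative_const]]])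
        (simp add: fun_eq_iff G'_def scaleC_add_right scaleC_scaleC scaleC_blinfun_compose mult.commute)
    have dH: "(H has_derivative (\<lambda>h. h *\<^sub>C H' z)) (at z)" if "z \<in> resolvent_set Q" for z
      unfolding H_def
      by (rule has_derivative_eq_rhs[OF scaleC.FDERIV[OF has_derivative_ident
            bounded_bilinear.FDERIV[OF bounded_bilinear_blinfun_compose has_derivative_const
              has_derivative_resolvent[OF Q that]]]])
        (simp add: fun_eq_iff H'_def scaleC_add_right scaleC_scaleC blinfun_compose_scaleC[OF Z] mult.commute)
    have cG': "continuous_on (resolvent_set P) G'" and cH': "continuous_on (resolvent_set Q) H'"
      unfolding G'_def H'_def
      by (intro continuous_intros scaleC.continuous_on continuous_on_resolvent P Q
          bounded_bilinear.continuous_on[OF bounded_bilinear_blinfun_compose])+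
    have UP: "U \<union> resolvent_set P = UNIV" and VQ: "V \<union> resolvent_set Q = UNIV"
      using U(2) V(2) by auto
    define fx where "fx z = (ux z *\<^sub>R G z + u z *\<^sub>R G' z) + (- ux z *\<^sub>R H z + (1 - u z) *\<^sub>R H' z)" for z
    define fy where "fy z = (uy z *\<^sub>R G z + u z *\<^sub>R (\<i> *\<^sub>C G' z))
        + (- uy z *\<^sub>R H z + (1 - u z) *\<^sub>R (\<i> *\<^sub>C H' z))" for z
    have f: "has_partials (\<lambda>z. u z *\<^sub>R G z + (1 - u z) *\<^sub>R H z) fx fy" (is "has_partials ?f fx fy")
      unfolding fx_def fy_def
      by (intro has_partials_add
          has_partials_cutoff[OF u U(1,3) open_resolvent_set[OF P] UP dG cG']
          has_partials_cutoff[OF has_partials_one_minus[OF u] V(1) _ open_resolvent_set[OF Q] VQ dH cH'])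
        (simp_all add: V(3))
    have dbar: "fx z + \<i> *\<^sub>C fy z = (w z * z) *\<^sub>C ((resolvent P z o\<^sub>L Z) - (Z o\<^sub>L resolvent Q z))" for z
    proof -
      have i: "\<i> *\<^sub>C \<i> *\<^sub>C y = - y" for y :: "'b \<Rightarrow>\<^sub>L 'a"
        by (simp add: scaleC_scaleC scaleC.minus_left scaleC_one)
      have wy: "w z *\<^sub>C y = ux z *\<^sub>R y + uy z *\<^sub>R (\<i> *\<^sub>C y)" for y :: "'b \<Rightarrow>\<^sub>L 'a"
        by (simp add: w_def scaleC_add_left scaleC_of_real mult.commute[of \<i>] flip: scaleC_scaleC)
      \<comment> \<open>The terms with \<open>G'\<close> and \<open>H'\<close> cancel because
        \<open>\<i>\<close> squared is -1; what is left comes from differentiating the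
        cutoff.\<close>
      have "fx z + \<i> *\<^sub>C fy z = w z *\<^sub>C (G z - H z)"
        unfolding fx_def fy_def wy
        by (simp add: scaleC_add_right scaleC.scaleR_right scaleC.diff_right i algebra_simps)
      then show ?thesis
        by (simp add: G_def H_def scaleC_scaleC scaleC.diff_right)
    qed
    define I where "I r = integral {0..2*pi} (\<lambda>t. cis (- t) *\<^sub>C
      (w (rcis r t) * rcis r t) *\<^sub>C ((resolvent P (rcis r t) o\<^sub>L Z) - (Z o\<^sub>L resolvent Q (rcis r t))))" for r
    define J where "J r = integral {0..2*pi} (\<lambda>t. ?f (rcis r t))" for r
    \<comment> \<open>Thanks to the factor \<open>z\<close> in \<open>G\<close> and
      \<open>H\<close>, the centre term of \<open>polar_Green\<close> drops out.\<close>
    have f0: "?f 0 = 0"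
      by (simp add: G_def H_def scaleC.zero_left)
    have Green: "(I has_integral J r) {0..r}" if "0 \<le> r" for r
      using polar_Green[OF f that] unfolding f0 dbar I_def J_def by simp
    \<comment> \<open>Beyond radius \<open>R\<close> the cutoff is constant, so the area integrand
      vanishes and \<open>J\<close> stops changing. \<open>J R\<close> can then be computed on
      arbitrarily large circles, where \<open>u = 1\<close> leaves just the \<open>P\<close>
      term.\<close>
    have JR: "J r = J R" if "r \<ge> R" for r
    proof -
      have "(I has_integral 0) {R..r}"
      proof (rule has_integral_is_0)
        fix s assume "s \<in> {R..r}"
        then have "cmod (rcis s t) > R0" for t
          using R by simp
        then show "I s = 0"
          using w0 V(4) by (simp add: I_def scaleC.zero_left scaleC.zero_right)
      qed
      from has_integral_combine[OF R(2) that Green[OF R(2)] this]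
      show ?thesis
        using has_integral_unique[OF Green[of r]] R(2) that by simp
    qed
    have "norm (J R + (2*pi) *\<^sub>R Z) \<le> 2 * pi * (norm P * norm Z) / (r - norm P)"
      if "r > max R (norm P)" for r
    proof -
      have "?f (rcis r t) = rcis r t *\<^sub>C (resolvent P (rcis r t) o\<^sub>L Z)" for t
        using that R V(3,4) by (simp add: G_def)
      then have "J R = integral {0..2*pi} (\<lambda>t. rcis r t *\<^sub>C (resolvent P (rcis r t) o\<^sub>L Z))"
        using JR[of r] that by (simp add: J_def)
      then show ?thesis
        using circle_integral_resolvent_bound[OF P, of r Z] that by simp
    qed
    then have ev: "\<forall>\<^sub>F r in at_top. norm (J R + (2*pi) *\<^sub>R Z) \<le> 2 * pi * (norm P * norm Z) / (r - norm P)"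
      using eventually_gt_at_top[of "max R (norm P)"] by (auto elim: eventually_mono)
    have "LIM r at_top. - norm P + r :> at_top"
      by (rule filterlim_tendsto_add_at_top[OF tendsto_const filterlim_ident])
    then have "LIM r at_top. r - norm P :> at_infinity"
      by (simp add: filterlim_at_top_imp_at_infinity)
    then have "((\<lambda>r. 2 * pi * (norm P * norm Z) / (r - norm P)) \<longlongrightarrow> 0) at_top"
      by (rule tendsto_divide_0[OF tendsto_const])
    \<comment> \<open>A fixed norm bounded by a quantity tending to 0 must be 0.\<close>
    from tendsto_lowerbound[OF this ev] have "J R = - (2*pi) *\<^sub>R Z"
      by (simp add: add_eq_0_iff2)
    then show "((\<lambda>r. integral {0..2*pi} (\<lambda>t. cis (- t) *\<^sub>C
      (w (rcis r t) * rcis r t) *\<^sub>C ((resolvent P (rcis r t) o\<^sub>L Z) - (Z o\<^sub>L resolvent Q (rcis r t)))))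
      has_integral - (2*pi) *\<^sub>R Z) {0..R}"
      using Green[OF R(2)] by (simp add: I_def[abs_def])
  qed (use U V R w0 in auto)
qed

text \<open>Transfers pointwise linear identities of the kernel to the iterated integral: first the
  commutator with \<open>P\<close> and \<open>Q\<close>, then complex homogeneity.\<close>

lemma bounded_linear_iterated_integral:
  fixes k :: "real \<Rightarrow> real \<Rightarrow> 'e::banach" and F :: "'e \<Rightarrow> 'f::banach"
  assumes F: "bounded_linear F" and k: "continuous_on UNIV (\<lambda>(r, t). k r t)"
  shows "((\<lambda>r. integral {a..b} (\<lambda>t. F (k r t))) has_integral
    F (integral {c..d} (\<lambda>r. integral {a..b} (k r)))) {c..d}"
proof -
  have "continuous_on {a..b} (k r)" for r
    by (rule continuous_on_compose2[OF k, of _ "Pair r", simplified]) (intro continuous_intros)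
  then have "integral {a..b} (\<lambda>t. F (k r t)) = F (integral {a..b} (k r))" for r
    using integral_linear[OF integrable_continuous_real F, of a b "k r"] by (simp add: o_def)
  moreover have "continuous_on {c..d} (\<lambda>r. integral (cbox a b) (k r))"
    by (rule integral_continuous_on_param) (rule continuous_on_subset[OF k], simp)
  then have "(\<lambda>r. integral {a..b} (k r)) integrable_on {c..d}"
    by (simp add: integrable_continuous_real)
  ultimately show ?thesis
    using has_integral_linear[OF integrable_integral F] by (simp add: o_def)
qed

text \<open>The representation of \<open>resolvent_splitting\<close> is used twice: with
  \<open>Z = D\<close> to verify the integral solution, and with a solution of the homogeneous
  equation to show that it is 0.\<close>

lemma Rosenblum_blinfun:
  fixes P :: "'a::complex_banach \<Rightarrow>\<^sub>L 'a" and Q :: "'b::complex_banach \<Rightarrow>\<^sub>L 'b"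
  assumes P: "clinear_blinfun P" and Q: "clinear_blinfun Q"
    and disj: "- resolvent_set P \<inter> - resolvent_set Q = {}"
    and D: "clinear_blinfun D"
  shows "\<exists>!X. clinear_blinfun X \<and> (P o\<^sub>L X) - (X o\<^sub>L Q) = D"
proof -
  obtain w :: "complex \<Rightarrow> complex" and N R where w: "continuous_on UNIV w" and N: "open N"
    "N \<union> (resolvent_set P \<inter> resolvent_set Q) = UNIV" "\<And>z. z \<in> N \<Longrightarrow> w z = 0" and R: "0 \<le> R"
    and rep: "\<And>Z. clinear_blinfun Z \<Longrightarrow> ((\<lambda>r. integral {0..2*pi} (\<lambda>t. cis (- t) *\<^sub>C
      (w (rcis r t) * rcis r t) *\<^sub>C ((resolvent P (rcis r t) o\<^sub>L Z) - (Z o\<^sub>L resolvent Q (rcis r t)))))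
      has_integral - (2*pi) *\<^sub>R Z) {0..R}"
    by (rule resolvent_splitting[OF P Q disj]) blast
  note bl = bounded_bilinear.bounded_linear_left[OF bounded_bilinear_blinfun_compose]
    bounded_bilinear.bounded_linear_right[OF bounded_bilinear_blinfun_compose]
    scaleC.bounded_linear_right bounded_linear_sub
  interpret l: bounded_bilinear "(o\<^sub>L) :: ('a \<Rightarrow>\<^sub>L 'a) \<Rightarrow> ('b \<Rightarrow>\<^sub>L 'a) \<Rightarrow> ('b \<Rightarrow>\<^sub>L 'a)"
    by (rule bounded_bilinear_blinfun_compose)
  interpret r: bounded_bilinear "(o\<^sub>L) :: ('b \<Rightarrow>\<^sub>L 'a) \<Rightarrow> ('b \<Rightarrow>\<^sub>L 'b) \<Rightarrow> ('b \<Rightarrow>\<^sub>L 'a)"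
    by (rule bounded_bilinear_blinfun_compose)
  define K where "K z = resolvent P z o\<^sub>L D o\<^sub>L resolvent Q z" for z
  \<comment> \<open>\<open>r\<close> is the Jacobian of polar coordinates; at
    \<open>z = rcis r t\<close> it equals \<open>cis (- t) * z\<close>, the factor appearing in
    \<open>rep\<close>.\<close>
  define k where "k r t = (complex_of_real r * w (rcis r t)) *\<^sub>C K (rcis r t)" for r t
  define Y where "Y = integral {0..R} (\<lambda>r. integral {0..2*pi} (k r))"
  \<comment> \<open>\<open>resolvent_intertwine\<close> reverses the sign of the integrand in
    \<open>rep\<close>, so \<open>P Y - Y Q\<close> is \<open>2 pi D\<close>, and
    \<open>2 pi\<close> is divided out.\<close>
  define X where "X = (1 / (2*pi)) *\<^sub>R Y"
  have cwK: "continuous_on UNIV (\<lambda>z. w z *\<^sub>C K z)"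
  proof -
    have "continuous_on N (\<lambda>z. w z *\<^sub>C K z)"
      using N(3) by (simp add: scaleC.zero_left cong: continuous_on_cong)
    moreover have "continuous_on (resolvent_set P \<inter> resolvent_set Q) (\<lambda>z. w z *\<^sub>C K z)"
      unfolding K_def
      by (intro continuous_intros scaleC.continuous_on bounded_bilinear.continuous_on[OF bounded_bilinear_blinfun_compose]
          continuous_on_subset[OF w] continuous_on_subset[OF continuous_on_resolvent[OF P]]
          continuous_on_subset[OF continuous_on_resolvent[OF Q]]) auto
    ultimately show ?thesis
      using continuous_on_open_Un[OF N(1) open_Int[OF open_resolvent_set[OF P] open_resolvent_set[OF Q]]] N(2)
      by metis
  qed
  have k: "continuous_on UNIV (\<lambda>(r, t). k r t)"
  proof -
    have rc: "continuous_on UNIV (\<lambda>x::real \<times> real. rcis (fst x) (snd x))"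
      unfolding rcis_def by (intro continuous_intros)
    have "continuous_on UNIV (\<lambda>x::real \<times> real. complex_of_real (fst x) *\<^sub>C w (rcis (fst x) (snd x)) *\<^sub>C K (rcis (fst x) (snd x)))"
      by (intro scaleC.continuous_on continuous_intros continuous_on_compose2[OF cwK rc]) auto
    then show ?thesis
      by (simp add: k_def scaleC_scaleC split_beta)
  qed
  have inN: "z \<in> N \<or> z \<in> resolvent_set P \<and> z \<in> resolvent_set Q" for z
    using N(2) by blast
  have "((\<lambda>r. integral {0..2*pi} (\<lambda>t. (P o\<^sub>L k r t) - (k r t o\<^sub>L Q))) has_integral
      ((P o\<^sub>L Y) - (Y o\<^sub>L Q))) {0..R}"
    unfolding Y_def by (rule bounded_linear_iterated_integral[OF _ k]) (intro bl)
  moreover have "(P o\<^sub>L k r t) - (k r t o\<^sub>L Q) = - (cis (- t) *\<^sub>C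
      (w (rcis r t) * rcis r t) *\<^sub>C ((resolvent P (rcis r t) o\<^sub>L D) - (D o\<^sub>L resolvent Q (rcis r t))))" for r t
  proof (cases "rcis r t \<in> N")
    case True
    then show ?thesis
      by (simp add: k_def N(3) scaleC.zero_left scaleC.zero_right l.zero_right r.zero_left)
  next
    case False
    then have z: "rcis r t \<in> resolvent_set P" "rcis r t \<in> resolvent_set Q"
      using inN by blast+
    have "(P o\<^sub>L k r t) - (k r t o\<^sub>L Q) = (complex_of_real r * w (rcis r t)) *\<^sub>C
        ((P o\<^sub>L K (rcis r t)) - (K (rcis r t) o\<^sub>L Q))"
      by (simp add: k_def blinfun_compose_scaleC[OF P] scaleC_blinfun_compose scaleC.diff_right)
    also have "\<dots> = (complex_of_real r * w (rcis r t)) *\<^sub>C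
        ((D o\<^sub>L resolvent Q (rcis r t)) - (resolvent P (rcis r t) o\<^sub>L D))"
      unfolding K_def by (simp only: resolvent_intertwine[OF P Q D z])
    also have "complex_of_real r * w (rcis r t) = cis (- t) * (w (rcis r t) * rcis r t)"
      using cis_mult[of "- t" t] by (simp add: rcis_def mult_ac)
    finally show ?thesis
      by (simp add: scaleC_scaleC scaleC.diff_right)
  qed
  ultimately have "((\<lambda>r. - integral {0..2*pi} (\<lambda>t. cis (- t) *\<^sub>C
      (w (rcis r t) * rcis r t) *\<^sub>C ((resolvent P (rcis r t) o\<^sub>L D) - (D o\<^sub>L resolvent Q (rcis r t)))))
      has_integral ((P o\<^sub>L Y) - (Y o\<^sub>L Q))) {0..R}"
    by simp
  from has_integral_unique[OF this has_integral_neg[OF rep[OF D]]]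
  have "(P o\<^sub>L Y) - (Y o\<^sub>L Q) = (2*pi) *\<^sub>R D"
    by simp
  then have XD: "(P o\<^sub>L X) - (X o\<^sub>L Q) = D"
    by (simp add: X_def l.scaleR_right r.scaleR_left flip: scaleR_diff_right)
  have clY: "clinear_blinfun Y"
  proof (intro allI)
    fix c y
    \<comment> \<open>This map measures the failure of homogeneity at \<open>c\<close> and
      \<open>y\<close>; it annihilates every \<open>k r t\<close>, hence also their integral
      \<open>Y\<close>.\<close>
    have "bounded_linear (\<lambda>f::'b \<Rightarrow>\<^sub>L 'a. f (c *\<^sub>C y) - c *\<^sub>C f y)"
      by (intro bounded_linear_sub blinfun.bounded_linear_left
          bounded_linear_compose[OF scaleC.bounded_linear_right blinfun.bounded_linear_left])
    from bounded_linear_iterated_integral[OF this k, of 0 "2*pi" 0 R]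
    have "((\<lambda>r. integral {0..2*pi} (\<lambda>t. k r t (c *\<^sub>C y) - c *\<^sub>C k r t y)) has_integral
        (Y (c *\<^sub>C y) - c *\<^sub>C Y y)) {0..R}"
      by (simp add: Y_def)
    moreover have "k r t (c *\<^sub>C y) - c *\<^sub>C k r t y = 0" for r t
    proof (cases "rcis r t \<in> N")
      case True
      then show ?thesis
        by (simp add: k_def N(3) scaleC.zero_left scaleC.zero_right)
    next
      case False
      then have z: "rcis r t \<in> resolvent_set P" "rcis r t \<in> resolvent_set Q"
        using inN by blast+
      show ?thesis
        using D resolvent_clinear[OF P z(1)] resolvent_clinear[OF Q z(2)]
        by (simp add: k_def K_def blinfun_apply_scaleC scaleC_scaleC mult.commute)
    qed
    ultimately have "((\<lambda>r. 0) has_integral (Y (c *\<^sub>C y) - c *\<^sub>C Y y)) {0..R}"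
      by simp
    then show "Y (c *\<^sub>C y) = c *\<^sub>C Y y"
      using has_integral_0_eq by auto
  qed
  have clX: "clinear_blinfun X"
    using clY by (simp add: X_def blinfun.scaleR_left scaleC.scaleR_right)
  \<comment> \<open>\<open>P Z = Z Q\<close> passes to the resolvents, so the integrand in
    \<open>rep\<close> vanishes and \<open>-2 pi Z\<close> is the integral of 0.\<close>
  have uniq: "Z = 0" if Z: "clinear_blinfun Z" and Z0: "(P o\<^sub>L Z) - (Z o\<^sub>L Q) = 0" for Z
  proof -
    have "(w z * z) *\<^sub>C ((resolvent P z o\<^sub>L Z) - (Z o\<^sub>L resolvent Q z)) = 0" for z
    proof (cases "z \<in> N")
      case True
      then show ?thesis
        by (simp add: N(3) scaleC.zero_left)
    next
      case False
      then have z: "z \<in> resolvent_set P" "z \<in> resolvent_set Q"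
        using inN by blast+
      have "resolvent P z (Z x) = Z (resolvent Q z x)" for x
      proof -
        define y where "y = resolvent Q z x"
        have x: "x = Q y - z *\<^sub>C y"
          using blinfun_apply_resolvent[OF z(2), of x] by (simp add: y_def)
        have "Z (Q y) = P (Z y)"
          using arg_cong[OF Z0, of "\<lambda>f. blinfun_apply f y"] by (simp add: blinfun.diff_left)
        then have "resolvent P z (Z x) = resolvent P z (P (Z y)) - z *\<^sub>C resolvent P z (Z y)"
          unfolding x using Z resolvent_clinear[OF P z(1)] by (simp add: blinfun.diff_right)
        then show ?thesis
          by (simp add: resolvent_blinfun_apply[OF P z(1)] y_def)
      qed
      then have "(resolvent P z o\<^sub>L Z) - (Z o\<^sub>L resolvent Q z) = 0"
        by (intro blinfun_eqI) (simp add: blinfun.diff_left)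
      then show ?thesis
        by (simp add: scaleC.zero_right)
    qed
    then have "((\<lambda>r::real. 0) has_integral - (2*pi) *\<^sub>R Z) {0..R}"
      using rep[OF Z] by (simp add: scaleC.zero_right)
    then show ?thesis
      using has_integral_0_eq by fastforce
  qed
  show ?thesis
  proof (rule ex1I[of _ X])
    show "clinear_blinfun X \<and> (P o\<^sub>L X) - (X o\<^sub>L Q) = D"
      using clX XD by blast
    fix W assume W: "clinear_blinfun W \<and> (P o\<^sub>L W) - (W o\<^sub>L Q) = D"
    have "W - X = 0"
    proof (rule uniq)
      show "clinear_blinfun (W - X)"
        using W clX by (simp add: blinfun.diff_left scaleC.diff_right)
      have "(P o\<^sub>L (W - X)) - ((W - X) o\<^sub>L Q) = ((P o\<^sub>L W) - (W o\<^sub>L Q)) - ((P o\<^sub>L X) - (X o\<^sub>L Q))"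
        by (simp add: l.diff_right r.diff_left)
      then show "(P o\<^sub>L (W - X)) - ((W - X) o\<^sub>L Q) = 0"
        using W XD by simp
    qed
    then show "W = X" by simp
  qed
qed


section \<open>Transfer from the operator type to bounded complex-linear functions\<close>

lemma bounded_clinear_blinfun_apply: "clinear_blinfun f \<Longrightarrow> bounded_clinear (blinfun_apply f)"
  by (simp add: bounded_clinear_def blinfun.bounded_linear_right)

lemma bounded_clinear_obtain_blinfun:
  assumes "bounded_clinear T"
  obtains f where "T = blinfun_apply f" "clinear_blinfun f"
  using assms by (intro that[of "Blinfun T"]) (simp_all add: bounded_clinear_def bounded_linear_Blinfun_apply)

text \<open>An inverse as in \<open>spectrum\<close> is bounded, hence a resolvent. So disjoint
  spectra yield the disjointness assumed in \<open>Rosenblum_blinfun\<close>.\<close>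

lemma Compl_resolvent_set_subset_spectrum: "- resolvent_set P \<subseteq> spectrum (blinfun_apply P)"
proof (rule ccontr)
  assume "\<not> ?thesis"
  then obtain z where z: "z \<notin> resolvent_set P" "z \<notin> spectrum (blinfun_apply P)"
    by auto
  then obtain S where S: "bounded_clinear S" "S \<circ> (\<lambda>x. P x - z *\<^sub>C x) = id" "(\<lambda>x. P x - z *\<^sub>C x) \<circ> S = id"
    unfolding spectrum_def by blast
  obtain U where U: "S = blinfun_apply U"
    using bounded_clinear_obtain_blinfun[OF S(1)] by blast
  have "is_resolvent P z U"
    using S(2,3) by (simp add: is_resolvent_iff U fun_eq_iff)
  with z show False
    by (auto simp: resolvent_set_def)
qed

lemma Rosenblum:
  fixes P :: "'a::complex_banach \<Rightarrow> 'a" and Q :: "'b::complex_banach \<Rightarrow> 'b"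
  assumes "bounded_clinear P" "bounded_clinear Q" "bounded_clinear D"
    and "spectrum P \<inter> spectrum Q = {}"
  shows "\<exists>!X. bounded_clinear X \<and> (P \<circ> X) - (X \<circ> Q) = D"
proof -
  obtain p where p: "P = blinfun_apply p" "clinear_blinfun p"
    using bounded_clinear_obtain_blinfun[OF assms(1)] .
  obtain q where q: "Q = blinfun_apply q" "clinear_blinfun q"
    using bounded_clinear_obtain_blinfun[OF assms(2)] .
  obtain d where d: "D = blinfun_apply d" "clinear_blinfun d"
    using bounded_clinear_obtain_blinfun[OF assms(3)] .
  have iff: "(P \<circ> blinfun_apply x) - (blinfun_apply x \<circ> Q) = D \<longleftrightarrow> (p o\<^sub>L x) - (x o\<^sub>L q) = d" for x
    by (simp add: p q d fun_eq_iff blinfun.diff_left flip: blinfun_apply_inject)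
  have "\<exists>!x. clinear_blinfun x \<and> (p o\<^sub>L x) - (x o\<^sub>L q) = d"
    using Compl_resolvent_set_subset_spectrum[of p] Compl_resolvent_set_subset_spectrum[of q] assms(4)
    by (intro Rosenblum_blinfun p q d) (auto simp: p q)
  then obtain x where x: "clinear_blinfun x" "(p o\<^sub>L x) - (x o\<^sub>L q) = d"
    "\<And>y. clinear_blinfun y \<Longrightarrow> (p o\<^sub>L y) - (y o\<^sub>L q) = d \<Longrightarrow> y = x"
    by blast
  show ?thesis
  proof (rule ex1I[of _ "blinfun_apply x"])
    show "bounded_clinear (blinfun_apply x) \<and> (P \<circ> blinfun_apply x) - (blinfun_apply x \<circ> Q) = D"
      using bounded_clinear_blinfun_apply[OF x(1)] x(2) iff by blast
    fix Y assume Y: "bounded_clinear Y \<and> (P \<circ> Y) - (Y \<circ> Q) = D"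
    then obtain y where "Y = blinfun_apply y" "clinear_blinfun y"
      using bounded_clinear_obtain_blinfun by blast
    then show "Y = blinfun_apply x"
      using x(3)[of y] Y iff[of y] by simp
  qed
qed

section \<open>Polynomials in operators\<close>

lemma bounded_clinear_compose:
  "bounded_clinear S \<Longrightarrow> bounded_clinear T \<Longrightarrow> bounded_clinear (\<lambda>x. S (T x))"
  by (simp add: bounded_clinear_def bounded_linear_compose)

lemma bounded_clinear_funpow: "bounded_clinear A \<Longrightarrow> bounded_clinear (A ^^ k)"
  for A :: "'a::complex_normed_vector \<Rightarrow> 'a"
  by (induction k) (auto simp: bounded_clinear_def bounded_linear_ident id_def o_def bounded_linear_compose)

lemma bounded_clinear_scaleC: "bounded_clinear T \<Longrightarrow> bounded_clinear (\<lambda>x. c *\<^sub>C T x)"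
  by (simp add: bounded_clinear_def scaleC_scaleC mult.commute
      bounded_linear_compose[OF scaleC.bounded_linear_right])

lemma bounded_clinear_diff:
  "bounded_clinear S \<Longrightarrow> bounded_clinear T \<Longrightarrow> bounded_clinear (\<lambda>x. S x - T x)"
  by (simp add: bounded_clinear_def bounded_linear_sub scaleC.diff_right)

lemma bounded_clinear_sum:
  "(\<And>i. i \<in> I \<Longrightarrow> bounded_clinear (T i)) \<Longrightarrow> bounded_clinear (\<lambda>x. \<Sum>i\<in>I. T i x)"
  by (simp add: bounded_clinear_def bounded_linear_sum scaleC.sum_right)

lemma bounded_clinear_poly_op: "bounded_clinear T \<Longrightarrow> bounded_clinear (poly_op p T)"
  unfolding poly_op_def by (intro bounded_clinear_sum bounded_clinear_scaleC bounded_clinear_funpow)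

lemma bounded_clinear_bipoly_op:
  "bounded_clinear A \<Longrightarrow> bounded_clinear B \<Longrightarrow> bounded_clinear Z \<Longrightarrow> bounded_clinear (bipoly_op f A B Z)"
  unfolding bipoly_op_def
  by (rule bounded_clinear_sum bounded_clinear_scaleC
      bounded_clinear_compose[OF bounded_clinear_funpow bounded_clinear_compose[OF _ bounded_clinear_funpow]]
      | assumption)+

text \<open>Coefficients above the degree are 0, so any common upper limit can replace the degree.
  The summand \<open>g\<close> is general so that coefficients may themselves be
  polynomials.\<close>

lemma sum_coeff_extend:
  assumes "\<And>i. g i 0 = 0" "degree p \<le> n"
  shows "(\<Sum>i\<le>degree p. g i (coeff p i)) = (\<Sum>i\<le>n. g i (coeff p i))"
  using assms by (intro sum.mono_neutral_left) (auto simp: coeff_eq_0)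

text \<open>The degree of a sum may drop, so all three sums are first extended to one upper
  limit.\<close>

lemma sum_coeff_add:
  assumes "\<And>i. g i 0 = 0" "\<And>i a b. g i (a + b) = g i a + g i b"
  shows "(\<Sum>i\<le>degree (p + q). g i (coeff (p + q) i)) =
    (\<Sum>i\<le>degree p. g i (coeff p i)) + (\<Sum>i\<le>degree q. g i (coeff q i))"
proof -
  define n where "n = max (degree p) (degree q)"
  have "degree p \<le> n" "degree q \<le> n" "degree (p + q) \<le> n"
    by (auto simp: n_def degree_add_le_max)
  show ?thesis
    unfolding sum_coeff_extend[where g=g, OF assms(1) \<open>degree p \<le> n\<close>]
      sum_coeff_extend[where g=g, OF assms(1) \<open>degree q \<le> n\<close>]
      sum_coeff_extend[where g=g, OF assms(1) \<open>degree (p + q) \<le> n\<close>]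
    by (simp add: assms(2) sum.distrib)
qed

lemma sum_coeff_monom:
  assumes "\<And>i. g i 0 = 0"
  shows "(\<Sum>i\<le>degree (monom c n). g i (coeff (monom c n) i)) = g n c"
proof -
  have "(\<Sum>i\<le>degree (monom c n). g i (coeff (monom c n) i)) = (\<Sum>i\<le>n. g i (coeff (monom c n) i))"
    using assms by (intro sum_coeff_extend degree_monom_le)
  also have "\<dots> = (\<Sum>i\<in>{n}. g i (coeff (monom c n) i))"
    using assms by (intro sum.mono_neutral_right) auto
  finally show ?thesis
    by simp
qed

text \<open>\<open>sum_coeff_add\<close> is used at both levels: for the inner sums it proves the
  additivity that its outer use requires.\<close>

lemma bipoly_op_add: "bipoly_op (f + g) A B Z y = bipoly_op f A B Z y + bipoly_op g A B Z y"
  unfolding bipoly_op_def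
  by (rule sum_coeff_add[where g="\<lambda>i c. \<Sum>j\<le>degree c. coeff c j *\<^sub>C (A ^^ i) (Z ((B ^^ j) y))"])
    (simp_all add: scaleC.zero_left scaleC.add_left
      sum_coeff_add[where g="\<lambda>j c. c *\<^sub>C (A ^^ _) (Z ((B ^^ j) y))"] del: coeff_add)

lemma bipoly_op_sum: "bipoly_op (\<Sum>k\<in>S. F k) A B Z y = (\<Sum>k\<in>S. bipoly_op (F k) A B Z y)"
proof -
  have "bipoly_op 0 A B Z y = 0"
    by (simp add: bipoly_op_def scaleC.zero_left)
  then show ?thesis
    by (induction S rule: infinite_finite_induct) (simp_all add: bipoly_op_add)
qed

lemma bipoly_op_monom:
  "bipoly_op (monom (monom c j) i) A B Z y = c *\<^sub>C (A ^^ i) (Z ((B ^^ j) y))"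
  unfolding bipoly_op_def
  by (subst sum_coeff_monom[where g="\<lambda>i c. \<Sum>j\<le>degree c. coeff c j *\<^sub>C (A ^^ i) (Z ((B ^^ j) y))"])
    (simp_all add: scaleC.zero_left sum_coeff_monom[where g="\<lambda>j c. c *\<^sub>C (A ^^ _) (Z ((B ^^ j) y))"]
      del: coeff_monom)

lemma bipoly_op_divided_difference:
  "bipoly_op (divided_difference p) A B Z y =
    (\<Sum>k=1..degree p. coeff p k *\<^sub>C (\<Sum>i<k. (A ^^ i) (Z ((B ^^ (k - 1 - i)) y))))"
  by (simp add: divided_difference_def bipoly_op_sum bipoly_op_monom scaleC.sum_right)

section \<open>Telescoping identities for the divided difference\<close>

lemma poly_op_commutator:
  assumes "bounded_clinear X"
  shows "(poly_op p A \<circ> X) - (X \<circ> poly_op p B) =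
    (\<lambda>y. \<Sum>k=1..degree p. coeff p k *\<^sub>C ((A ^^ k) (X y) - X ((B ^^ k) y)))"
proof
  fix y
  have X: "X (\<Sum>i\<in>I. c i *\<^sub>C f i) = (\<Sum>i\<in>I. c i *\<^sub>C X (f i))" for I :: "nat set" and c f
    using assms by (simp add: bounded_clinear_def linear_sum bounded_linear.linear)
  have "((poly_op p A \<circ> X) - (X \<circ> poly_op p B)) y =
      (\<Sum>k\<le>degree p. coeff p k *\<^sub>C ((A ^^ k) (X y) - X ((B ^^ k) y)))"
    by (simp add: poly_op_def X scaleC.diff_right sum_subtractf)
  \<comment> \<open>The constant coefficient cancels in the commutator, which matches the index
    range of \<open>divided_difference\<close>.\<close>
  also have "\<dots> = (\<Sum>k=1..degree p. coeff p k *\<^sub>C ((A ^^ k) (X y) - X ((B ^^ k) y)))"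
    by (rule sum.mono_neutral_right) (auto simp: not_less_eq_eq scaleC.zero_right)
  finally show "((poly_op p A \<circ> X) - (X \<circ> poly_op p B)) y =
      (\<Sum>k=1..degree p. coeff p k *\<^sub>C ((A ^^ k) (X y) - X ((B ^^ k) y)))" .
qed

text \<open>Operator form of the factorisation of \<open>a^k - b^k\<close>: consecutive terms are
  \<open>A^i X B^(k-i)\<close> for \<open>i\<close> and \<open>i + 1\<close>.\<close>

lemma funpow_telescope:
  fixes X :: "'y \<Rightarrow> 'x::ab_group_add"
  shows "(\<Sum>i<k. (A ^^ Suc i) (X ((B ^^ (k - 1 - i)) y)) - (A ^^ i) (X ((B ^^ Suc (k - 1 - i)) y)))
    = (A ^^ k) (X y) - X ((B ^^ k) y)"
proof -
  have "(\<Sum>i<k. (A ^^ Suc i) (X ((B ^^ (k - 1 - i)) y)) - (A ^^ i) (X ((B ^^ Suc (k - 1 - i)) y)))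
    = (\<Sum>i<k. (A ^^ Suc i) (X ((B ^^ (k - Suc i)) y)) - (A ^^ i) (X ((B ^^ (k - i)) y)))"
    \<comment> \<open>Truncated subtraction is harmless: \<open>i < k\<close> gives
      \<open>Suc (k - 1 - i) = k - i\<close>.\<close>
    by (intro sum.cong refl arg_cong2[where f="(-)"]) (auto simp: Suc_diff_Suc simp del: funpow.simps)
  also have "\<dots> = (A ^^ k) (X y) - X ((B ^^ k) y)"
    by (subst sum_lessThan_telescope) simp
  finally show ?thesis .
qed

text \<open>The operator counterpart of \<open>divided_difference_eq\<close>, with the commutator
  with \<open>A\<close> and \<open>B\<close> applied before \<open>q(A,B)\<close>; linearity of the
  powers of \<open>A\<close> splits each term for telescoping.\<close>

lemma divided_difference_commutator:
  assumes A: "bounded_clinear A" and X: "bounded_clinear X"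
  shows "bipoly_op (divided_difference p) A B ((A \<circ> X) - (X \<circ> B)) = (poly_op p A \<circ> X) - (X \<circ> poly_op p B)"
proof
  fix y
  have Ak: "(A ^^ i) (u - v) = (A ^^ i) u - (A ^^ i) v" for i u v
    using bounded_clinear_funpow[OF A, of i] by (simp add: bounded_clinear_def bounded_linear.linear linear_diff)
  have "bipoly_op (divided_difference p) A B ((A \<circ> X) - (X \<circ> B)) y =
    (\<Sum>k=1..degree p. coeff p k *\<^sub>C (\<Sum>i<k. (A ^^ Suc i) (X ((B ^^ (k - 1 - i)) y)) - (A ^^ i) (X ((B ^^ Suc (k - 1 - i)) y))))"
    by (simp add: bipoly_op_divided_difference Ak funpow_swap1)
  then show "bipoly_op (divided_difference p) A B ((A \<circ> X) - (X \<circ> B)) y = ((poly_op p A \<circ> X) - (X \<circ> poly_op p B)) y"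
    by (simp only: funpow_telescope poly_op_commutator[OF X])
qed

text \<open>The same telescoping sum arises when the commutator is applied after
  \<open>q(A,B)\<close>, because left and right multiplications commute.\<close>

lemma commutator_divided_difference:
  assumes A: "bounded_clinear A" and X: "bounded_clinear X"
  shows "(A \<circ> bipoly_op (divided_difference p) A B X) - (bipoly_op (divided_difference p) A B X \<circ> B) =
    (poly_op p A \<circ> X) - (X \<circ> poly_op p B)"
proof
  fix y
  have As: "A (\<Sum>i\<in>I. f i) = (\<Sum>i\<in>I. A (f i))" "A (c *\<^sub>C u) = c *\<^sub>C A u" for I :: "nat set" and f c u
    using A by (simp_all add: bounded_clinear_def linear_sum bounded_linear.linear)
  have "((A \<circ> bipoly_op (divided_difference p) A B X) - (bipoly_op (divided_difference p) A B X \<circ> B)) y =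
    (\<Sum>k=1..degree p. coeff p k *\<^sub>C (\<Sum>i<k. (A ^^ Suc i) (X ((B ^^ (k - 1 - i)) y)) - (A ^^ i) (X ((B ^^ Suc (k - 1 - i)) y))))"
    by (simp add: bipoly_op_divided_difference As sum_subtractf scaleC.diff_right funpow_swap1)
  then show "((A \<circ> bipoly_op (divided_difference p) A B X) - (bipoly_op (divided_difference p) A B X \<circ> B)) y
    = ((poly_op p A \<circ> X) - (X \<circ> poly_op p B)) y"
    by (simp only: funpow_telescope poly_op_commutator[OF X])
qed

theorem proposition2p4:
  fixes A :: "'x::complex_banach \<Rightarrow> 'x"
    and B :: "'y::complex_banach \<Rightarrow> 'y"
    and C :: "'y \<Rightarrow> 'x"
    and p :: "complex poly"
  assumes "bounded_clinear A" and "bounded_clinear B" and "bounded_clinear C"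
    and "spectrum (poly_op p A) \<inter> spectrum (poly_op p B) = {}"
  shows "(\<exists>!X. bounded_clinear X \<and>
            (poly_op p A \<circ> X) - (X \<circ> poly_op p B) = bipoly_op (divided_difference p) A B C) \<and>
         (\<forall>X. bounded_clinear X \<and>
            (poly_op p A \<circ> X) - (X \<circ> poly_op p B) = bipoly_op (divided_difference p) A B C
            \<longrightarrow> (A \<circ> X) - (X \<circ> B) = C)"
proof (intro conjI allI impI)
  \<comment> \<open>The right-hand side is kept general: existence and uniqueness use
    \<open>q(A,B)(C)\<close>, and the final cancellation uses
    \<open>p(A) C - C p(B)\<close>.\<close>
  have solvable: "\<exists>!X. bounded_clinear X \<and> (poly_op p A \<circ> X) - (X \<circ> poly_op p B) = D"
    if "bounded_clinear D" for D
    using that assms by (intro Rosenblum bounded_clinear_poly_op)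
  show "\<exists>!X. bounded_clinear X \<and>
      (poly_op p A \<circ> X) - (X \<circ> poly_op p B) = bipoly_op (divided_difference p) A B C"
    using assms by (intro solvable bounded_clinear_bipoly_op)
  fix X
  assume X: "bounded_clinear X \<and>
    (poly_op p A \<circ> X) - (X \<circ> poly_op p B) = bipoly_op (divided_difference p) A B C"
  define Y where "Y = (A \<circ> X) - (X \<circ> B)"
  have "Y = (\<lambda>y. A (X y) - X (B y))"
    by (simp add: Y_def fun_eq_iff)
  then have Y: "bounded_clinear Y"
    using X assms by (simp add: bounded_clinear_diff bounded_clinear_compose)
  have "(poly_op p A \<circ> Y) - (Y \<circ> poly_op p B) =
      (A \<circ> bipoly_op (divided_difference p) A B Y) - (bipoly_op (divided_difference p) A B Y \<circ> B)"
    using commutator_divided_difference[OF assms(1) Y] by simp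
  also have "bipoly_op (divided_difference p) A B Y = bipoly_op (divided_difference p) A B C"
    unfolding Y_def
    using divided_difference_commutator[OF assms(1) conjunct1[OF X]] conjunct2[OF X] by (rule trans)
  also have "(A \<circ> bipoly_op (divided_difference p) A B C) - (bipoly_op (divided_difference p) A B C \<circ> B) =
      (poly_op p A \<circ> C) - (C \<circ> poly_op p B)"
    by (rule commutator_divided_difference[OF assms(1,3)])
  finally have YC: "(poly_op p A \<circ> Y) - (Y \<circ> poly_op p B) = (poly_op p A \<circ> C) - (C \<circ> poly_op p B)" .
  have "bounded_clinear ((poly_op p A \<circ> C) - (C \<circ> poly_op p B))"
    using bounded_clinear_diff[OF bounded_clinear_compose[OF bounded_clinear_poly_op assms(3)]
        bounded_clinear_compose[OF assms(3) bounded_clinear_poly_op], OF assms(1,2)]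
    by (simp add: fun_diff_def o_def)
  \<comment> \<open>Both \<open>Y\<close> and \<open>C\<close> solve the equation with right-hand
    side \<open>p(A) C - C p(B)\<close>, so uniqueness identifies them.\<close>
  note S = the1_equality[OF solvable[OF this]]
  show "(A \<circ> X) - (X \<circ> B) = C"
    using S[OF conjI[OF Y YC]] S[OF conjI[OF assms(3) refl]] unfolding Y_def by (rule trans[OF sym])
qed

end
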